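(* Let $H$ be a $3$-hypergraph, and suppose that for every forest $F$ on the vertex set $V(H)$ a root is fixed in each component of $F$. Then there exist a $3$-hypergraph $\tilde H$ related to $H$ and an acyclic quasigraph $\sigma$ in $\tilde H$ such that $\sigma$ has no bad leaves (with respect to the roots fixed for the forest $\sigma^*$) and $V(\tilde H)$ admits a $\sigma$-skeletal partition $\mathcal S$ (with respect to $\tilde H$).
   Context: A $3$-hypergraph is a finite hypergraph (multiple hyperedges allowed) all of whose hyperedges have size $2$ or $3$. A quasigraph $\pi$ in $H$ assigns to each hyperedge $e$ either a $2$-subset of $e$ or $\emptyset$; $e$ is used if $\pi(e)\ne\emptyset$. $\pi^*$ is the graph on $V(H)$ whose edges are the pairs $\pi(e)$, $e$ used; $\pi$ is acyclic if $\pi^*$ is a forest; $\pi$ is a quasicycle if $\pi^*$ is a cycle plus isolated vertices; a $3$-hypergraph is acyclic if it admits no quasicycle. For a partition $\mathcal P$ of $V(H)$, a hyperedge (or pair) is $\mathcal P$-crossing if it meets at least two classes, and $e/\mathcal P$ is the set of classes met by $e$; $H/\mathcal P$ is the $3$-hypergraph on vertex set $\mathcal P$ with one hyperedge $e/\mathcal P$ per $\mathcal P$-crossing hyperedge $e$; $\pi/\mathcal P$ is the quasigraph in $H/\mathcal P$ with value $\pi(e)/\mathcal P$ on $e/\mathcal P$ if $\pi(e)$ is $\mathcal P$-crossing and $\emptyset$ otherwise; $\overline{\pi/\mathcal P}$ is the subhypergraph of $H/\mathcal P$ of hyperedges unused by $\pi/\mathcal P$. $\pi$ is connected on $X\subseteq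 V(H)$ if $\pi^*[X]$ is connected, and anticonnected on $X$ if for every partition $\mathcal R$ of $X$ with at least two classes some hyperedge $f$ meets at least two classes of $\mathcal R$ while $\pi(f)$ lies in one class (possibly $\pi(f)=\emptyset$). A partition $\mathcal P$ of $V(H)$ is $\pi$-skeletal if $\pi$ is connected and anticonnected on each class of $\mathcal P$ and $\overline{\pi/\mathcal P}$ is acyclic. Bad leaves and switches: for acyclic $\pi$, orient each edge of $\pi^*$ towards the root of its component; a used hyperedge $e$ is associated with $u$ if $u$ is the tail of $\pi(e)$. A vertex $u$ is a bad leaf for $\pi$ if $u$ is a leaf of $\pi^*$, $u$ is incident with exactly three hyperedges, exactly one of which, $e$, has size $3$, and $e$ is associated with $u$; then the hyperedges at $u$ are $ua,ub,ucd$ with $\pi(ucd)=\{u,c\}$. The switch at $u$ replaces $ua,ub,ucd$ by $uab,uc,ud$, producing $H^{(u)}$ and the quasigraph $\pi^{(u)}$ with value $\{u,c\}$ on $uc$, unused $ud,uab$, and equal to $\pi$ elsewhere. A hypergraph is related to $H$ if it can be obtained from $H$ by a finite sequence of switch operations (each at a bad leaf of some acyclic quasigraph in the current hypergraph). *)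

theory Defs
  imports Main "HOL-Library.Disjoint_Sets"
begin

text \<open>Hyperedges are labels, so that several of them may have the same set of ends. The same
  record serves for multigraphs, where every edge has two ends; in particular two parallel edges
  form a cycle of length 2.\<close>

record ('v, 'e) hypergraph =
  verts :: "'v set"
  hedges :: "'e set"
  ends :: "'e \<Rightarrow> 'v set"

definition three_hypergraph :: "('v, 'e) hypergraph \<Rightarrow> bool" where
  "three_hypergraph H \<longleftrightarrow> finite (verts H) \<and> finite (hedges H) \<and>
     (\<forall>e\<in>hedges H. ends H e \<subseteq> verts H \<and> card (ends H e) \<in> {2, 3})"

definition incident_hedges :: "('v, 'e) hypergraph \<Rightarrow> 'v \<Rightarrow> 'e set" where
  "incident_hedges H v = {e \<in> hedges H. v \<in> ends H e}"

definition multigraph :: "('v, 'e) hypergraph \<Rightarrow> bool" where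
  "multigraph G \<longleftrightarrow> (\<forall>e\<in>hedges G. ends G e \<subseteq> verts G \<and> card (ends G e) = 2)"

definition graph_path :: "('v, 'e) hypergraph \<Rightarrow> 'v list \<Rightarrow> 'e list \<Rightarrow> bool" where
  "graph_path G vs es \<longleftrightarrow> length vs = Suc (length es) \<and> distinct vs \<and>
     set vs \<subseteq> verts G \<and> set es \<subseteq> hedges G \<and>
     (\<forall>i<length es. ends G (es ! i) = {vs ! i, vs ! Suc i})"

definition joined :: "('v, 'e) hypergraph \<Rightarrow> 'v \<Rightarrow> 'v \<Rightarrow> bool" where
  "joined G x y \<longleftrightarrow> (\<exists>vs es. graph_path G vs es \<and> hd vs = x \<and> last vs = y)"

definition graph_connected :: "('v, 'e) hypergraph \<Rightarrow> bool" where
  "graph_connected G \<longleftrightarrow> (\<forall>x\<in>verts G. \<forall>y\<in>verts G. joined G x y)"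

definition graph_cycle :: "('v, 'e) hypergraph \<Rightarrow> 'v list \<Rightarrow> 'e list \<Rightarrow> bool" where
  "graph_cycle G vs es \<longleftrightarrow> length vs = length es \<and> 2 \<le> length es \<and> distinct vs \<and> distinct es \<and>
     set vs \<subseteq> verts G \<and> set es \<subseteq> hedges G \<and>
     (\<forall>i<length es. ends G (es ! i) = {vs ! i, vs ! (Suc i mod length vs)})"

definition forest :: "('v, 'e) hypergraph \<Rightarrow> bool" where
  "forest G \<longleftrightarrow> multigraph G \<and> \<not> (\<exists>vs es. graph_cycle G vs es)"

definition component_of :: "('v, 'e) hypergraph \<Rightarrow> 'v \<Rightarrow> 'v set" where
  "component_of G v = {w \<in> verts G. joined G v w}"

definition leaf :: "('v, 'e) hypergraph \<Rightarrow> 'v \<Rightarrow> bool" where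
  "leaf G v \<longleftrightarrow> v \<in> verts G \<and> card (incident_hedges G v) = 1"

definition induced :: "('v, 'e) hypergraph \<Rightarrow> 'v set \<Rightarrow> ('v, 'e) hypergraph" where
  "induced G X = \<lparr>verts = X, hedges = {e \<in> hedges G. ends G e \<subseteq> X}, ends = ends G\<rparr>"


definition quasigraph :: "('v, 'e) hypergraph \<Rightarrow> ('e \<Rightarrow> 'v set) \<Rightarrow> bool" where
  "quasigraph H \<pi> \<longleftrightarrow>
     (\<forall>e\<in>hedges H. \<pi> e = {} \<or> (\<pi> e \<subseteq> ends H e \<and> card (\<pi> e) = 2))"

definition used :: "('v, 'e) hypergraph \<Rightarrow> ('e \<Rightarrow> 'v set) \<Rightarrow> 'e set" where
  "used H \<pi> = {e \<in> hedges H. \<pi> e \<noteq> {}}"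

text \<open>The multigraph $\pi^*$.\<close>

definition star :: "('v, 'e) hypergraph \<Rightarrow> ('e \<Rightarrow> 'v set) \<Rightarrow> ('v, 'e) hypergraph" where
  "star H \<pi> = \<lparr>verts = verts H, hedges = used H \<pi>, ends = \<pi>\<rparr>"

definition acyclic_quasigraph :: "('v, 'e) hypergraph \<Rightarrow> ('e \<Rightarrow> 'v set) \<Rightarrow> bool" where
  "acyclic_quasigraph H \<pi> \<longleftrightarrow> quasigraph H \<pi> \<and> forest (star H \<pi>)"

text \<open>All edges of $\pi^*$ lie on the cycle, so every vertex off the cycle is isolated.\<close>

definition quasicycle :: "('v, 'e) hypergraph \<Rightarrow> ('e \<Rightarrow> 'v set) \<Rightarrow> bool" where
  "quasicycle H \<pi> \<longleftrightarrow> quasigraph H \<pi> \<and>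
     (\<exists>vs es. graph_cycle (star H \<pi>) vs es \<and> set es = hedges (star H \<pi>))"

definition acyclic_hypergraph :: "('v, 'e) hypergraph \<Rightarrow> bool" where
  "acyclic_hypergraph H \<longleftrightarrow> \<not> (\<exists>\<pi>. quasicycle H \<pi>)"


definition classes_met :: "'v set set \<Rightarrow> 'v set \<Rightarrow> 'v set set" where
  "classes_met P e = {A \<in> P. A \<inter> e \<noteq> {}}"

definition crossing :: "'v set set \<Rightarrow> 'v set \<Rightarrow> bool" where
  "crossing P e \<longleftrightarrow> (\<exists>A\<in>classes_met P e. \<exists>B\<in>classes_met P e. A \<noteq> B)"

definition contract :: "('v, 'e) hypergraph \<Rightarrow> 'v set set \<Rightarrow> ('v set, 'e) hypergraph" where
  "contract H P = \<lparr>verts = P, hedges = {e \<in> hedges H. crossing P (ends H e)},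
     ends = (\<lambda>e. classes_met P (ends H e))\<rparr>"

definition contract_quasi :: "('e \<Rightarrow> 'v set) \<Rightarrow> 'v set set \<Rightarrow> 'e \<Rightarrow> 'v set set" where
  "contract_quasi \<pi> P = (\<lambda>e. if crossing P (\<pi> e) then classes_met P (\<pi> e) else {})"

definition unused_part :: "('v, 'e) hypergraph \<Rightarrow> ('e \<Rightarrow> 'v set) \<Rightarrow> ('v, 'e) hypergraph" where
  "unused_part H \<pi> = H\<lparr>hedges := hedges H - used H \<pi>\<rparr>"

definition connected_on :: "('v, 'e) hypergraph \<Rightarrow> ('e \<Rightarrow> 'v set) \<Rightarrow> 'v set \<Rightarrow> bool" where
  "connected_on H \<pi> X \<longleftrightarrow> graph_connected (induced (star H \<pi>) X)"

definition anticonnected_on :: "('v, 'e) hypergraph \<Rightarrow> ('e \<Rightarrow> 'v set) \<Rightarrow> 'v set \<Rightarrow> bool" where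
  "anticonnected_on H \<pi> X \<longleftrightarrow> (\<forall>R. partition_on X R \<and> 2 \<le> card R \<longrightarrow>
     (\<exists>f\<in>hedges H. crossing R (ends H f) \<and> (\<exists>A\<in>R. \<pi> f \<subseteq> A)))"

definition skeletal :: "('v, 'e) hypergraph \<Rightarrow> ('e \<Rightarrow> 'v set) \<Rightarrow> 'v set set \<Rightarrow> bool" where
  "skeletal H \<pi> P \<longleftrightarrow> partition_on (verts H) P \<and>
     (\<forall>X\<in>P. connected_on H \<pi> X \<and> anticonnected_on H \<pi> X) \<and>
     acyclic_hypergraph (unused_part (contract H P) (contract_quasi \<pi> P))"


text \<open>A choice of roots \<open>r\<close> assigns a root \<open>r F C\<close> to every component (vertex set) \<open>C\<close> of every
  forest with edge set \<open>F\<close> on a given vertex set. Forests have no parallel edges, so \<open>F\<close> can be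
  taken to be a set of pairs.\<close>

type_synonym 'v roots = "'v set set \<Rightarrow> 'v set \<Rightarrow> 'v"

definition root_choice :: "'v set \<Rightarrow> 'v roots \<Rightarrow> bool" where
  "root_choice V r \<longleftrightarrow> (\<forall>F. let G = \<lparr>verts = V, hedges = F, ends = id\<rparr> in
     forest G \<longrightarrow> (\<forall>C \<in> component_of G ` V. r F C \<in> C))"

definition root_of :: "'v roots \<Rightarrow> ('v, 'e) hypergraph \<Rightarrow> 'v \<Rightarrow> 'v" where
  "root_of r G v = r (ends G ` hedges G) (component_of G v)"

text \<open>An edge of a forest directed towards the root has tail \<open>u\<close> iff it is the first edge of the
  path from \<open>u\<close> to the root.\<close>

definition is_tail :: "'v roots \<Rightarrow> ('v, 'e) hypergraph \<Rightarrow> 'e \<Rightarrow> 'v \<Rightarrow> bool" where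
  "is_tail r G e u \<longleftrightarrow> (\<exists>vs es. graph_path G vs (e # es) \<and> hd vs = u \<and> last vs = root_of r G u)"

definition associated ::
    "'v roots \<Rightarrow> ('v, 'e) hypergraph \<Rightarrow> ('e \<Rightarrow> 'v set) \<Rightarrow> 'e \<Rightarrow> 'v \<Rightarrow> bool" where
  "associated r H \<pi> e u \<longleftrightarrow> e \<in> used H \<pi> \<and> is_tail r (star H \<pi>) e u"

definition bad_leaf :: "'v roots \<Rightarrow> ('v, 'e) hypergraph \<Rightarrow> ('e \<Rightarrow> 'v set) \<Rightarrow> 'v \<Rightarrow> bool" where
  "bad_leaf r H \<pi> u \<longleftrightarrow> leaf (star H \<pi>) u \<and> card (incident_hedges H u) = 3 \<and>
     (\<exists>e. {f \<in> incident_hedges H u. card (ends H f) = 3} = {e} \<and> associated r H \<pi> e u)"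

text \<open>The labels of the three hyperedges at \<open>u\<close> are reused for the three new ones. If \<open>a = b\<close>, that
  is, if the two hyperedges of size 2 at \<open>u\<close> are parallel, then the new hyperedge \<open>{u, a, b}\<close> has
  size 2.\<close>

inductive switch_at ::
    "'v roots \<Rightarrow> 'v \<Rightarrow> ('v, 'e) hypergraph \<Rightarrow> ('e \<Rightarrow> 'v set) \<Rightarrow>
     ('v, 'e) hypergraph \<Rightarrow> ('e \<Rightarrow> 'v set) \<Rightarrow> bool" for r u H \<pi> where
  "switch_at r u H \<pi>
     (H\<lparr>ends := (ends H)(e1 := {u, a, b}, e2 := {u, d}, e3 := {u, c})\<rparr>)
     (\<pi>(e1 := {}, e2 := {}, e3 := {u, c}))"
  if "bad_leaf r H \<pi> u"
    and "incident_hedges H u = {e1, e2, e3}" and "distinct [e1, e2, e3]"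
    and "ends H e1 = {u, a}" and "ends H e2 = {u, b}"
    and "ends H e3 = {u, c, d}" and "\<pi> e3 = {u, c}"

definition switch_step ::
    "'v roots \<Rightarrow> ('v, 'e) hypergraph \<Rightarrow> ('v, 'e) hypergraph \<Rightarrow> bool" where
  "switch_step r H H' \<longleftrightarrow> (\<exists>\<pi> \<pi>' u. acyclic_quasigraph H \<pi> \<and> switch_at r u H \<pi> H' \<pi>')"

definition related ::
    "'v roots \<Rightarrow> ('v, 'e) hypergraph \<Rightarrow> ('v, 'e) hypergraph \<Rightarrow> bool" where
  "related r H H' \<longleftrightarrow> (switch_step r)\<^sup>*\<^sup>* H H'"

end

(*
  For an acyclic quasigraph pi refine the partition {V(H)} alternately into the components of pi^*
  and into anticomponents, and choose a related hypergraph together with pi such that the resulting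
  sequence of partitions is lexicographically as coarse as possible. If the complement of the final
  contracted quasigraph has a quasicycle, look at the first stage at which the quasicycle is split
  into several components: one of its hyperedges e can be made to connect two of them, without loss
  of anticonnectivity because e lies on a quasicycle, and if this closes a cycle of pi^*, then
  another hyperedge of that cycle is released and improves an earlier stage.

  The difficulty is a hyperedge e = {x,x',z} with x, x' in one class of the final partition and z
  outside: e may be needed inside the class of x. Such an e is therefore discarded, and the
  refinement goes on without e inside that class. When nothing new is discarded, the final partition
  is skeletal.

  A switch at a bad leaf u leaves pi unchanged as a graph and only adds anticonnectivity. Let
  ucd be its hyperedge with pi(ucd) = {u,c}. Either the sequence is not affected, and a used
  hyperedge of size 3 disappears, or u and c are separated at some stage, and a used hyperedge of
  size 3 that crosses that stage disappears; this is made part of the lexicographic order.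
*)

theory Submission
  imports Defs "HOL-Library.Product_Lexorder"
begin

section \<open>Refining partitions by components and anticomponents\<close>

text \<open>Equivalence relations make "coarser" an inclusion, and coarseness is measured by
  cardinality. Anticomponents are generated from below: \<open>anti_rel\<close> is the least
  equivalence that merges the ends of a hyperedge, inside a class of \<open>C\<close>, once its own
  pair \<pi>(f) has been merged. Hence "still anticonnected without e" is always an induction in
  which e must be shown to contribute nothing.

  Discarding a hyperedge stores evidence: an earlier stage at which two of its ends lie in different
  components but are joined by free hyperedges other than itself. So when the hyperedge released
  from a cycle turns out to be a discarded one, this evidence allows a further exchange at a
  strictly earlier stage, and the exchange argument is an induction on the stage.

  Labels survive a switch, so one and the same function \<pi> serves before and after it, and the
  two sequences of partitions can be compared stage by stage.\<close>

text \<open>Partitions are represented by their equivalence relations. The relation \<open>conn_rel\<close> refines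
  \<open>Q\<close> into the components of $\pi^*$ within its classes, and \<open>anti_rel\<close> refines \<open>C\<close> into
  the anticomponents, both with respect to the hyperedges in \<open>E\<close>.\<close>
definition pair_links :: "('e \<Rightarrow> 'v set) \<Rightarrow> 'e set \<Rightarrow> 'v rel" where
  "pair_links \<pi> E = {(x, y). \<exists>f\<in>E. \<pi> f = {x, y}}"

definition conn_rel :: "('e \<Rightarrow> 'v set) \<Rightarrow> 'e set \<Rightarrow> 'v rel \<Rightarrow> 'v rel" where
  "conn_rel \<pi> E Q = Q \<inter> (Q \<inter> pair_links \<pi> E)\<^sup>*"

inductive_set anti_rel :: "('e \<Rightarrow> 'v set) \<Rightarrow> ('e \<Rightarrow> 'v set) \<Rightarrow> 'e set \<Rightarrow> 'v rel \<Rightarrow> 'v rel"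
  for N \<pi> E C where
  refl: "(x, x) \<in> C \<Longrightarrow> (x, x) \<in> anti_rel N \<pi> E C"
| sym: "(x, y) \<in> anti_rel N \<pi> E C \<Longrightarrow> (y, x) \<in> anti_rel N \<pi> E C"
| trans: "(x, y) \<in> anti_rel N \<pi> E C \<Longrightarrow> (y, z) \<in> anti_rel N \<pi> E C \<Longrightarrow> (x, z) \<in> anti_rel N \<pi> E C"
| edge: "f \<in> E \<Longrightarrow> \<forall>p\<in>\<pi> f. \<forall>q\<in>\<pi> f. (p, q) \<in> anti_rel N \<pi> E C \<Longrightarrow>
    x \<in> N f \<Longrightarrow> y \<in> N f \<Longrightarrow> (x, y) \<in> C \<Longrightarrow> (x, y) \<in> anti_rel N \<pi> E C"

text \<open>The condition \<open>\<pi> f \<times> \<pi> f \<subseteq> P\<close>, used throughout,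
  says that \<pi>(f) is empty or lies in one class of \<open>P\<close>, so that \<open>f\<close> is
  free after contracting \<open>P\<close>. A chain of links is a walk along free hyperedges modulo
  \<open>P\<close>, each hyperedge being used inside a class of \<open>Q\<close>.\<close>

definition free_links :: "('e \<Rightarrow> 'v set) \<Rightarrow> ('e \<Rightarrow> 'v set) \<Rightarrow> 'e set \<Rightarrow> 'v rel \<Rightarrow> 'v rel \<Rightarrow> 'v rel" where
  "free_links N \<pi> E Q P = P \<union> {(x, y) \<in> Q. \<exists>f\<in>E. x \<in> N f \<and> y \<in> N f \<and> \<pi> f \<times> \<pi> f \<subseteq> P}"

text \<open>Here \<open>P\<close> is the current partition and \<open>S\<close> records the earlier stages. A hyperedge \<open>g\<close> that meets
  a class of \<open>P\<close> in two vertices \<open>x\<close>, \<open>x'\<close> and has its third vertex \<open>z\<close> outside is discarded if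
  at an earlier stage it crossed two components, although free hyperedges other than \<open>g\<close> join
  these components modulo \<open>P\<close>. Later stages may then not use \<open>g\<close> inside the class of \<open>x\<close>, so that
  $\pi(g)$ can be redirected to \<open>z\<close>.\<close>
definition discards ::
    "('v, 'e) hypergraph \<Rightarrow> ('e \<Rightarrow> 'v set) \<Rightarrow> 'v rel \<Rightarrow> ('v rel \<times> 'e set \<times> 'v rel) set \<Rightarrow> 'e set" where
  "discards H \<pi> P S = {g \<in> hedges H. card (ends H g) = 3 \<and> (\<exists>x x' z. ends H g = {x, x', z} \<and>
     (x, x') \<in> P \<and> (x, z) \<notin> P \<and> \<pi> g \<times> \<pi> g \<subseteq> P \<and>
     (\<exists>(Q, E, C)\<in>S. (x, z) \<in> Q \<and> (x, z) \<notin> C \<and> (x, z) \<in> (free_links (ends H) \<pi> (E - {g}) Q P)\<^sup>*))}"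

lemma discardsI:
  assumes "g \<in> hedges H" "card (ends H g) = 3" "ends H g = {x, x', z}" "(x, x') \<in> P" "(x, z) \<notin> P"
    "\<pi> g \<times> \<pi> g \<subseteq> P" "(Q, E, C) \<in> S" "(x, z) \<in> Q" "(x, z) \<notin> C"
    "(x, z) \<in> (free_links (ends H) \<pi> (E - {g}) Q P)\<^sup>*"
  shows "g \<in> discards H \<pi> P S"
  using assms unfolding discards_def by fastforce

lemma card_discards: "g \<in> discards H \<pi> P S \<Longrightarrow> card (ends H g) = 3"
  unfolding discards_def by blast

text \<open>\<open>D\<close> collects the discarded hyperedges, \<open>S\<close> the triples (Q, E,
  C) of the completed stages. Discarding is decided for the new partition \<open>Q'\<close> against
  \<open>S'\<close>, so the stage that has just produced \<open>Q'\<close> already counts as an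
  earlier one.\<close>

primrec state :: "('v, 'e) hypergraph \<Rightarrow> ('e \<Rightarrow> 'v set) \<Rightarrow> nat \<Rightarrow>
    'v rel \<times> 'e set \<times> ('v rel \<times> 'e set \<times> 'v rel) set" where
  "state H \<pi> 0 = (verts H \<times> verts H, {}, {})"
| "state H \<pi> (Suc n) = (case state H \<pi> n of (Q, D, S) \<Rightarrow>
     let E = hedges H - D; C = conn_rel \<pi> E Q; Q' = anti_rel (ends H) \<pi> E C;
         S' = insert (Q, E, C) S
     in (Q', D \<union> discards H \<pi> Q' S', S'))"

definition anti_lv :: "('v, 'e) hypergraph \<Rightarrow> ('e \<Rightarrow> 'v set) \<Rightarrow> nat \<Rightarrow> 'v rel" where
  "anti_lv H \<pi> n = fst (state H \<pi> n)"

definition live :: "('v, 'e) hypergraph \<Rightarrow> ('e \<Rightarrow> 'v set) \<Rightarrow> nat \<Rightarrow> 'e set" where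
  "live H \<pi> n = hedges H - fst (snd (state H \<pi> n))"

definition conn_lv :: "('v, 'e) hypergraph \<Rightarrow> ('e \<Rightarrow> 'v set) \<Rightarrow> nat \<Rightarrow> 'v rel" where
  "conn_lv H \<pi> n = conn_rel \<pi> (live H \<pi> n) (anti_lv H \<pi> n)"

definition hist :: "('v, 'e) hypergraph \<Rightarrow> ('e \<Rightarrow> 'v set) \<Rightarrow> nat \<Rightarrow> ('v rel \<times> 'e set \<times> 'v rel) set" where
  "hist H \<pi> n = {(anti_lv H \<pi> i, live H \<pi> i, conn_lv H \<pi> i) | i. i < n}"

lemma hist_Suc: "hist H \<pi> (Suc n) = insert (anti_lv H \<pi> n, live H \<pi> n, conn_lv H \<pi> n) (hist H \<pi> n)"
  unfolding hist_def by (auto simp: less_Suc_eq)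

text \<open>The hypergraph and quasigraph of the discards are kept apart from those of the history,
  because a switched hypergraph will be measured against the history of the original one.\<close>

lemma discards_histE:
  assumes "g \<in> discards H' \<rho> P (hist H \<pi> (Suc k))"
  obtains x x' z i where "ends H' g = {x, x', z}" "card (ends H' g) = 3" "(x, x') \<in> P" "(x, z) \<notin> P"
    "i \<le> k" "(x, z) \<in> anti_lv H \<pi> i" "(x, z) \<notin> conn_lv H \<pi> i"
    "(x, z) \<in> (free_links (ends H') \<rho> (live H \<pi> i - {g}) (anti_lv H \<pi> i) P)\<^sup>*"
proof -
  obtain x x' z Q E C where *: "ends H' g = {x, x', z}" "card (ends H' g) = 3" "(x, x') \<in> P"
    "(x, z) \<notin> P" "(Q, E, C) \<in> hist H \<pi> (Suc k)" "(x, z) \<in> Q" "(x, z) \<notin> C"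
    "(x, z) \<in> (free_links (ends H') \<rho> (E - {g}) Q P)\<^sup>*"
    using assms unfolding discards_def by blast
  from *(5) obtain i where "Q = anti_lv H \<pi> i" "E = live H \<pi> i" "C = conn_lv H \<pi> i" "i \<le> k"
    unfolding hist_def by auto
  with * that show thesis by simp
qed

lemma state_hist: "snd (snd (state H \<pi> n)) = hist H \<pi> n"
proof (induction n)
  case 0
  show ?case by (simp add: hist_def)
next
  case (Suc n)
  then show ?case
    by (simp add: hist_Suc Let_def split_beta conn_lv_def live_def anti_lv_def)
qed

lemma anti_lv_0 [simp]: "anti_lv H \<pi> 0 = verts H \<times> verts H"
  by (simp add: anti_lv_def)

lemma live_0 [simp]: "live H \<pi> 0 = hedges H"
  by (simp add: live_def)

lemma anti_lv_Suc: "anti_lv H \<pi> (Suc n) = anti_rel (ends H) \<pi> (live H \<pi> n) (conn_lv H \<pi> n)"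
  by (simp add: anti_lv_def live_def conn_lv_def Let_def split_beta)

lemma live_Suc:
  "live H \<pi> (Suc n) = live H \<pi> n - discards H \<pi> (anti_lv H \<pi> (Suc n)) (hist H \<pi> (Suc n))"
proof -
  have "live H \<pi> (Suc n) = hedges H - (fst (snd (state H \<pi> n)) \<union>
      discards H \<pi> (anti_lv H \<pi> (Suc n)) (hist H \<pi> (Suc n)))"
    unfolding live_def anti_lv_Suc hist_Suc
    by (simp add: Let_def split_beta conn_lv_def live_def anti_lv_def state_hist)
  then show ?thesis
    unfolding live_def by blast
qed

lemma live_subset_hedges: "live H \<pi> n \<subseteq> hedges H"
  by (simp add: live_def)

section \<open>Monotonicity and induction principles for the two refinements\<close>

lemma pair_links_mono: "E \<subseteq> E' \<Longrightarrow> pair_links \<pi> E \<subseteq> pair_links \<pi> E'"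
  unfolding pair_links_def by blast

lemma sym_pair_links: "sym (pair_links \<pi> E)"
  unfolding pair_links_def sym_def by (auto simp: insert_commute)

lemma sym_rtrancl_sym: "(x, y) \<in> R\<^sup>* \<Longrightarrow> sym R \<Longrightarrow> (y, x) \<in> R\<^sup>*"
  by (meson sym_rtrancl symD)

lemma conn_rel_subset: "conn_rel \<pi> E Q \<subseteq> Q"
  unfolding conn_rel_def by blast

lemma equiv_conn_rel:
  assumes "equiv V Q"
  shows "equiv V (conn_rel \<pi> E Q)"
proof -
  have s: "sym ((Q \<inter> pair_links \<pi> E)\<^sup>*)"
    using assms by (intro sym_rtrancl sym_Int sym_pair_links) (auto simp: equiv_def)
  show ?thesis
    unfolding conn_rel_def equiv_def
    using assms s
    by (auto simp: equiv_def refl_on_def intro!: sym_Int trans_Int trans_rtrancl)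
qed

lemma conn_rel_subsetI:
  assumes "Q \<subseteq> Q'" "Q \<inter> pair_links \<pi> E \<subseteq> conn_rel \<rho> E' Q'"
  shows "conn_rel \<pi> E Q \<subseteq> conn_rel \<rho> E' Q'"
proof -
  have "(Q \<inter> pair_links \<pi> E)\<^sup>* \<subseteq> ((Q' \<inter> pair_links \<rho> E')\<^sup>*)\<^sup>*"
    using assms(2) unfolding conn_rel_def by (intro rtrancl_mono) blast
  then show ?thesis
    using assms(1) unfolding conn_rel_def by auto
qed

lemma conn_rel_mono: "Q \<subseteq> Q' \<Longrightarrow> E \<subseteq> E' \<Longrightarrow> conn_rel \<pi> E Q \<subseteq> conn_rel \<pi> E' Q'"
  unfolding conn_rel_def
  by (intro Int_mono rtrancl_mono) (auto dest: pair_links_mono)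

lemma conn_relI: "(x, y) \<in> Q \<Longrightarrow> f \<in> E \<Longrightarrow> \<pi> f = {x, y} \<Longrightarrow> (x, y) \<in> conn_rel \<pi> E Q"
  unfolding conn_rel_def pair_links_def by blast

lemma anti_rel_subset:
  assumes "equiv V C"
  shows "anti_rel N \<pi> E C \<subseteq> C"
proof (rule subrelI)
  fix x y assume "(x, y) \<in> anti_rel N \<pi> E C"
  then show "(x, y) \<in> C"
    using assms
    by (induction rule: anti_rel.induct) (auto simp: equiv_def dest: symD transD)
qed

lemma equiv_anti_rel:
  assumes "equiv V C"
  shows "equiv V (anti_rel N \<pi> E C)"
proof (rule equivI)
  show "anti_rel N \<pi> E C \<subseteq> V \<times> V"
    using anti_rel_subset[OF assms] assms unfolding equiv_def by fast
  show "refl_on V (anti_rel N \<pi> E C)"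
    using assms by (auto simp: equiv_def refl_on_def intro: anti_rel.refl)
qed (auto simp: sym_def trans_def intro: anti_rel.sym anti_rel.trans)

text \<open>Induction over the generated equivalence, keeping membership in \<open>anti_rel\<close>
  itself available in the edge case. Proofs that a hyperedge is dispensable need it: they ask which
  pairs of its ends are related at the new level, not just in \<open>C\<close>.\<close>

lemma anti_rel_subsetI:
  assumes R: "equiv V R" and C: "equiv V C"
    and step: "\<And>f x y. f \<in> E \<Longrightarrow> \<pi> f \<times> \<pi> f \<subseteq> R \<Longrightarrow> \<pi> f \<times> \<pi> f \<subseteq> anti_rel N \<pi> E C \<Longrightarrow>
      x \<in> N f \<Longrightarrow> y \<in> N f \<Longrightarrow> (x, y) \<in> C \<Longrightarrow> (x, y) \<in> anti_rel N \<pi> E C \<Longrightarrow> (x, y) \<in> R"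
  shows "anti_rel N \<pi> E C \<subseteq> R"
proof (rule subrelI)
  fix x y assume "(x, y) \<in> anti_rel N \<pi> E C"
  then show "(x, y) \<in> R"
  proof (induction rule: anti_rel.induct)
    case (refl x)
    then show ?case using R C by (auto simp: equiv_def refl_on_def)
  next
    case (sym x y)
    then show ?case using R by (auto simp: equiv_def dest: symD)
  next
    case (trans x y z)
    then show ?case using R by (auto simp: equiv_def dest: transD)
  next
    case (edge f x y)
    have "(x, y) \<in> anti_rel N \<pi> E C"
      using edge by (intro anti_rel.edge[of f]) auto
    with edge show ?case
      by (intro step[of f]) auto
  qed
qed

lemma anti_rel_edgeI:
  "f \<in> E \<Longrightarrow> \<pi> f \<times> \<pi> f \<subseteq> anti_rel N \<pi> E C \<Longrightarrow> x \<in> N f \<Longrightarrow> y \<in> N f \<Longrightarrow> (x, y) \<in> C \<Longrightarrow>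
   (x, y) \<in> anti_rel N \<pi> E C"
  by (rule anti_rel.edge[of f]) auto

lemma anti_rel_mono:
  assumes "equiv V C" "equiv V C'" "E \<subseteq> E'" "C \<subseteq> C'"
    and step: "\<And>f. f \<in> E \<Longrightarrow> \<pi> f \<times> \<pi> f \<subseteq> anti_rel N \<rho> E' C' \<Longrightarrow> \<rho> f \<times> \<rho> f \<subseteq> anti_rel N \<rho> E' C'"
  shows "anti_rel N \<pi> E C \<subseteq> anti_rel N \<rho> E' C'"
proof (rule anti_rel_subsetI[OF equiv_anti_rel[OF assms(2)] assms(1)])
  fix f x y
  assume f: "f \<in> E" "\<pi> f \<times> \<pi> f \<subseteq> anti_rel N \<rho> E' C'" "x \<in> N f" "y \<in> N f" "(x, y) \<in> C"
  then show "(x, y) \<in> anti_rel N \<rho> E' C'"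
    using assms(3,4) step[OF f(1,2)] by (intro anti_rel_edgeI[of f]) blast+
qed

text \<open>Turns the evidence stored by \<open>discards\<close> into the hypothesis of an exchange:
  once \<open>P\<close> is generated by \<open>E\<close>, free walks modulo \<open>P\<close> are
  absorbed by the anticomponents. The condition \<open>imp\<close> lets the quasigraph change in
  between.\<close>

lemma free_links_anti_rel:
  assumes Q: "equiv V Q" and P: "P \<subseteq> anti_rel N \<rho> E Q"
    and imp: "\<And>f. f \<in> E \<Longrightarrow> \<pi> f \<times> \<pi> f \<subseteq> P \<Longrightarrow> \<rho> f \<times> \<rho> f \<subseteq> P"
    and xy: "(x, y) \<in> (free_links N \<pi> E Q P)\<^sup>*" "(x, y) \<in> Q"
  shows "(x, y) \<in> anti_rel N \<rho> E Q"
proof -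
  have "free_links N \<pi> E Q P \<subseteq> anti_rel N \<rho> E Q"
  proof (rule subrelI)
    fix x y assume "(x, y) \<in> free_links N \<pi> E Q P"
    then consider "(x, y) \<in> P"
      | f where "(x, y) \<in> Q" "f \<in> E" "x \<in> N f" "y \<in> N f" "\<pi> f \<times> \<pi> f \<subseteq> P"
      unfolding free_links_def by blast
    then show "(x, y) \<in> anti_rel N \<rho> E Q"
    proof cases
      case 2
      then show ?thesis using imp P by (intro anti_rel_edgeI[of f]) blast+
    qed (use P in blast)
  qed
  then have "(x, y) \<in> (anti_rel N \<rho> E Q)\<^sup>*"
    using xy(1) rtrancl_mono by blast
  moreover have "trans (anti_rel N \<rho> E Q)"
    using equiv_anti_rel[OF Q, of N \<rho> E] by (simp add: equiv_def)
  ultimately have "x = y \<or> (x, y) \<in> anti_rel N \<rho> E Q"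
    by (metis rtranclD trancl_id)
  then show ?thesis using xy(2) anti_rel.refl by metis
qed

lemma equiv_pair: "equiv V R \<Longrightarrow> (u, v) \<in> R \<Longrightarrow> {u, v} \<times> {u, v} \<subseteq> R"
  by (auto simp: equiv_def refl_on_def dest: symD)

text \<open>Applied to a discarded hyperedge, this says that x and x' are the only two vertices that
  it can merge inside \<open>P\<close>.\<close>

lemma related_pair_of_triple:
  assumes "equiv V P" "(x, x') \<in> P" "(x, z) \<notin> P" "p \<in> {x, x', z}" "q \<in> {x, x', z}"
    "(p, q) \<in> P" "p \<noteq> q"
  shows "{p, q} = {x, x'}"
proof -
  have "(x', z) \<notin> P" "(z, x) \<notin> P" "(z, x') \<notin> P"
    using assms(1-3) unfolding equiv_def by (meson symD transD)+
  then show ?thesis using assms by auto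
qed

lemma equiv_levels:
  "equiv (verts H) (anti_lv H \<pi> n)" "equiv (verts H) (conn_lv H \<pi> n)"
proof -
  show *: "equiv (verts H) (anti_lv H \<pi> n)" for n
  proof (induction n)
    case 0
    show ?case by (simp add: equiv_def refl_on_def sym_def trans_def)
  next
    case (Suc n)
    then show ?case
      unfolding anti_lv_Suc conn_lv_def by (intro equiv_anti_rel equiv_conn_rel)
  qed
  show "equiv (verts H) (conn_lv H \<pi> n)"
    unfolding conn_lv_def by (rule equiv_conn_rel[OF *])
qed

lemma conn_lv_subset: "conn_lv H \<pi> n \<subseteq> anti_lv H \<pi> n"
  unfolding conn_lv_def by (rule conn_rel_subset)

lemma anti_lv_Suc_subset: "anti_lv H \<pi> (Suc n) \<subseteq> conn_lv H \<pi> n"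
  unfolding anti_lv_Suc by (rule anti_rel_subset[OF equiv_levels(2)])

lemma anti_lv_antimono: "m \<le> n \<Longrightarrow> anti_lv H \<pi> n \<subseteq> anti_lv H \<pi> m"
  using anti_lv_Suc_subset conn_lv_subset by (metis lift_Suc_antimono_le subset_trans)

lemma anti_lv_subset_conn_lv: "m < n \<Longrightarrow> anti_lv H \<pi> n \<subseteq> conn_lv H \<pi> m"
  using anti_lv_antimono[of "Suc m" n] anti_lv_Suc_subset by (metis Suc_leI subset_trans)

lemma live_antimono: "m \<le> n \<Longrightarrow> live H \<pi> n \<subseteq> live H \<pi> m"
  by (rule lift_Suc_antimono_le) (auto simp: live_Suc)

lemma pair_in_live: "e \<in> hedges H \<Longrightarrow> card (ends H e) = 2 \<Longrightarrow> e \<in> live H \<pi> n"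
proof (induction n)
  case (Suc n)
  then show ?case by (simp add: live_Suc discards_def)
qed simp

section \<open>Acyclic quasigraphs\<close>

text \<open>Every edge of \<pi>* is a bridge. Removing labels rather than pairs makes two parallel
  edges count as a cycle; \<open>forest_star_iff\<close> translates to cycles given by
  lists.\<close>

definition acyc :: "('v, 'e) hypergraph \<Rightarrow> ('e \<Rightarrow> 'v set) \<Rightarrow> bool" where
  "acyc H \<pi> \<longleftrightarrow> (\<forall>e\<in>hedges H. \<forall>a b. \<pi> e = {a, b} \<longrightarrow> (a, b) \<notin> (pair_links \<pi> (hedges H - {e}))\<^sup>*)"

text \<open>A walk is kept a path by cutting it back whenever the next vertex has been visited
  before.\<close>

lemma rtrancl_graph_path:
  assumes "(x, y) \<in> {(x, y). y \<in> verts G \<and> (\<exists>e\<in>F. ends G e = {x, y})}\<^sup>*"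
    and "x \<in> verts G" and "F \<subseteq> hedges G"
  shows "\<exists>vs es. graph_path G vs es \<and> hd vs = x \<and> last vs = y \<and> set es \<subseteq> F"
  using assms(1)
proof (induction rule: rtrancl_induct)
  case base
  show ?case
    using assms(2) by (intro exI[of _ "[x]"] exI[of _ "[]"]) (auto simp: graph_path_def)
next
  case (step y z)
  from step.IH obtain vs es where p: "graph_path G vs es" "hd vs = x" "last vs = y" "set es \<subseteq> F"
    by blast
  from step.hyps(2) obtain e where e: "z \<in> verts G" "e \<in> F" "ends G e = {y, z}" by blast
  from p(1) have len: "length vs = Suc (length es)" and "distinct vs" "set vs \<subseteq> verts G"
    and ends: "\<And>i. i < length es \<Longrightarrow> ends G (es ! i) = {vs ! i, vs ! Suc i}"
    by (auto simp: graph_path_def)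
  show ?case
  proof (cases "z \<in> set vs")
    case True
    then obtain k where k: "k < length vs" "vs ! k = z" by (auto simp: in_set_conv_nth)
    have "graph_path G (take (Suc k) vs) (take k es)"
      using p(1,4) k len ends set_take_subset[of k es] set_take_subset[of "Suc k" vs]
      by (auto simp: graph_path_def)
    moreover have "hd (take (Suc k) vs) = x"
      using p(2) by simp
    moreover have "last (take (Suc k) vs) = z"
      using k by (simp add: take_Suc_conv_app_nth)
    ultimately show ?thesis
      using p(4) set_take_subset[of k es]
      by (intro exI[of _ "take (Suc k) vs"] exI[of _ "take k es"]) auto
  next
    case False
    have "vs \<noteq> []" using len by auto
    have "ends G ((es @ [e]) ! i) = {(vs @ [z]) ! i, (vs @ [z]) ! Suc i}" if "i < Suc (length es)" for i
    proof (cases "i = length es")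
      case True
      then show ?thesis
        using e(3) p(3) len \<open>vs \<noteq> []\<close> by (simp add: nth_append last_conv_nth)
    next
      case False
      then show ?thesis
        using that ends[of i] len by (simp add: nth_append)
    qed
    then have "graph_path G (vs @ [z]) (es @ [e])"
      using p(1) False e assms(3) by (auto simp: graph_path_def)
    then show ?thesis
      using p e \<open>vs \<noteq> []\<close> by (intro exI[of _ "vs @ [z]"] exI[of _ "es @ [e]"]) auto
  qed
qed

text \<open>The n - 1 cyclic steps that start at \<open>Suc k\<close> end at \<open>k\<close> and
  never use step \<open>k\<close>.\<close>

lemma around_cycle:
  assumes "k < n" "\<And>i. i < n \<Longrightarrow> i \<noteq> k \<Longrightarrow> (vs ! i, vs ! (Suc i mod n)) \<in> R"
  shows "(vs ! (Suc k mod n), vs ! k) \<in> R\<^sup>*"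
proof -
  have "(vs ! (Suc k mod n), vs ! ((Suc k + j) mod n)) \<in> R\<^sup>*" if "j < n" for j
    using that
  proof (induction j)
    case (Suc j)
    have "(Suc k + j) mod n \<noteq> k"
      using assms(1) Suc.prems by (cases "Suc k + j < n") (auto simp: mod_if)
    then have "(vs ! ((Suc k + j) mod n), vs ! (Suc ((Suc k + j) mod n) mod n)) \<in> R"
      using assms by simp
    with Suc show ?case by (auto simp: mod_Suc_eq intro: rtrancl_into_rtrancl)
  qed simp
  from this[of "n - 1"] assms(1) show ?thesis by simp
qed

text \<open>A walk needs the added pair at most once.\<close>

lemma rtrancl_insert_pair:
  assumes "(p, q) \<in> (L \<union> {(a, b), (b, a)})\<^sup>*" "sym L"
  shows "(p, q) \<in> L\<^sup>* \<or> (p, a) \<in> L\<^sup>* \<and> (b, q) \<in> L\<^sup>* \<or> (p, b) \<in> L\<^sup>* \<and> (a, q) \<in> L\<^sup>*"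
  using assms(1)
proof (induction rule: rtrancl_induct)
  case (step y z)
  then show ?case
    by (auto intro: rtrancl_into_rtrancl)
qed simp

text \<open>If another edge came to lie on a cycle, this cycle would pass through the new pair, and
  the rest of it would join \<open>a\<close> and \<open>b\<close> in the old graph.\<close>

lemma acyc_insert:
  assumes "acyc H \<pi>" "e \<in> hedges H" "\<pi> e = {}" "(a, b) \<notin> (pair_links \<pi> (hedges H))\<^sup>*"
  shows "acyc H (\<pi>(e := {a, b}))"
  unfolding acyc_def
proof (intro ballI allI impI notI)
  fix f p q
  let ?\<rho> = "\<pi>(e := {a, b})" and ?E = "hedges H"
  assume f: "f \<in> ?E" "?\<rho> f = {p, q}" "(p, q) \<in> (pair_links ?\<rho> (?E - {f}))\<^sup>*"
  let ?L = "pair_links \<pi> (?E - {f})"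
  have L: "?L\<^sup>* \<subseteq> (pair_links \<pi> ?E)\<^sup>*"
    by (intro rtrancl_mono pair_links_mono) blast
  have s: "sym ?L" "sym (pair_links \<pi> ?E)" by (rule sym_pair_links)+
  show False
  proof (cases "f = e")
    case True
    have "pair_links ?\<rho> (?E - {e}) = ?L"
      unfolding True pair_links_def by auto
    with f True L have "(p, q) \<in> (pair_links \<pi> ?E)\<^sup>*" by auto
    moreover have "p = a \<and> q = b \<or> p = b \<and> q = a"
      using f(2) True by (auto simp: doubleton_eq_iff)
    ultimately show False using assms(4) sym_rtrancl_sym[OF _ s(2)] by blast
  next
    case False
    then have pf: "\<pi> f = {p, q}" using f by simp
    have "pair_links ?\<rho> (?E - {f}) \<subseteq> ?L \<union> {(a, b), (b, a)}"
      unfolding pair_links_def by (auto simp: doubleton_eq_iff split: if_splits)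
    then have "(p, q) \<in> (?L \<union> {(a, b), (b, a)})\<^sup>*"
      using f(3) rtrancl_mono by blast
    moreover have "(p, q) \<notin> ?L\<^sup>*" using assms(1) f(1) pf unfolding acyc_def by blast
    ultimately have "(p, a) \<in> ?L\<^sup>* \<and> (b, q) \<in> ?L\<^sup>* \<or> (p, b) \<in> ?L\<^sup>* \<and> (a, q) \<in> ?L\<^sup>*"
      using rtrancl_insert_pair[OF _ s(1)] by blast
    moreover have "(p, q) \<in> pair_links \<pi> ?E" "(q, p) \<in> pair_links \<pi> ?E"
      using pf f(1) unfolding pair_links_def by (auto simp: insert_commute)
    ultimately have "(a, b) \<in> (pair_links \<pi> ?E)\<^sup>*"
      using L s sym_rtrancl_sym[OF _ s(2)]
      by (smt (verit, ccfv_SIG) r_into_rtrancl rtrancl_trans subsetD)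
    then show False using assms(4) by contradiction
  qed
qed

lemma acyc_remove:
  assumes "acyc H \<pi>"
  shows "acyc H (\<pi>(f := {}))"
proof -
  have "pair_links (\<pi>(f := {})) E \<subseteq> pair_links \<pi> E" for E
    unfolding pair_links_def by auto
  then have "(pair_links (\<pi>(f := {})) E)\<^sup>* \<subseteq> (pair_links \<pi> E)\<^sup>*" for E
    by (rule rtrancl_mono)
  with assms show ?thesis unfolding acyc_def by (fastforce split: if_splits)
qed

text \<open>A minimal \<open>F\<close> stands for the edge set of the path from \<open>a\<close> to
  \<open>b\<close>; no order of its edges is needed later.\<close>

lemma minimal_connection:
  assumes "finite E" "(a, b) \<in> (pair_links \<pi> E)\<^sup>*"
  obtains F where "F \<subseteq> E" "(a, b) \<in> (pair_links \<pi> F)\<^sup>*"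
    "\<forall>f\<in>F. (a, b) \<notin> (pair_links \<pi> (F - {f}))\<^sup>*"
proof -
  have "\<exists>F\<subseteq>E. (a, b) \<in> (pair_links \<pi> F)\<^sup>* \<and> (\<forall>f\<in>F. (a, b) \<notin> (pair_links \<pi> (F - {f}))\<^sup>*)"
    using assms
  proof (induction E rule: finite_psubset_induct)
    case (psubset E)
    show ?case
    proof (cases "\<forall>f\<in>E. (a, b) \<notin> (pair_links \<pi> (E - {f}))\<^sup>*")
      case True
      with psubset.prems show ?thesis by blast
    next
      case False
      then obtain f where f: "f \<in> E" "(a, b) \<in> (pair_links \<pi> (E - {f}))\<^sup>*" by blast
      from psubset.IH[OF _ f(2)] f(1) obtain F where "F \<subseteq> E - {f}"
        "(a, b) \<in> (pair_links \<pi> F)\<^sup>*" "\<forall>f\<in>F. (a, b) \<notin> (pair_links \<pi> (F - {f}))\<^sup>*" by auto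
      then show ?thesis by blast
    qed
  qed
  with that show thesis by blast
qed

text \<open>As \<open>f\<close> cannot be omitted, every connection passes it, and the rest of
  \<open>F\<close> reaches its two ends from the two sides.\<close>

lemma connection_split:
  assumes "(a, b) \<in> (pair_links \<pi> F)\<^sup>*" "(a, b) \<notin> (pair_links \<pi> (F - {f}))\<^sup>*"
  obtains u v where "\<pi> f = {u, v}" "(a, u) \<in> (pair_links \<pi> (F - {f}))\<^sup>*"
    "(v, b) \<in> (pair_links \<pi> (F - {f}))\<^sup>*"
proof -
  let ?L = "pair_links \<pi> (F - {f})"
  have s: "sym ?L" by (rule sym_pair_links)
  show thesis
  proof (cases "\<exists>u v. \<pi> f = {u, v}")
    case False
    then have "pair_links \<pi> F \<subseteq> ?L" unfolding pair_links_def by blast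
    then show thesis using assms rtrancl_mono by blast
  next
    case True
    then obtain u v where uv: "\<pi> f = {u, v}" by blast
    then have "pair_links \<pi> F \<subseteq> ?L \<union> {(u, v), (v, u)}"
      unfolding pair_links_def by (auto simp: doubleton_eq_iff)
    then have "(a, b) \<in> (?L \<union> {(u, v), (v, u)})\<^sup>*"
      using assms(1) rtrancl_mono by blast
    from rtrancl_insert_pair[OF this s] assms(2)
    consider "(a, u) \<in> ?L\<^sup>*" "(v, b) \<in> ?L\<^sup>*" | "(a, v) \<in> ?L\<^sup>*" "(u, b) \<in> ?L\<^sup>*" by blast
    then show thesis
      using that uv by cases (auto simp: insert_commute)
  qed
qed

text \<open>Paths in a forest are unique: a connection that avoids \<open>f\<close>, together with
  the two halves of \<open>F - {f}\<close>, would join the ends of \<open>f\<close> without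
  \<open>f\<close>.\<close>

lemma acyc_connection_unique:
  assumes "acyc H \<pi>" "F \<subseteq> hedges H" "f \<in> F" "(a, b) \<in> (pair_links \<pi> F)\<^sup>*"
    "(a, b) \<notin> (pair_links \<pi> (F - {f}))\<^sup>*"
  shows "(a, b) \<notin> (pair_links \<pi> (hedges H - {f}))\<^sup>*"
proof
  assume ab: "(a, b) \<in> (pair_links \<pi> (hedges H - {f}))\<^sup>*"
  from assms(4,5) obtain u v where uv: "\<pi> f = {u, v}" "(a, u) \<in> (pair_links \<pi> (F - {f}))\<^sup>*"
    "(v, b) \<in> (pair_links \<pi> (F - {f}))\<^sup>*" by (rule connection_split)
  have "(pair_links \<pi> (F - {f}))\<^sup>* \<subseteq> (pair_links \<pi> (hedges H - {f}))\<^sup>*"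
    using assms(2) by (intro rtrancl_mono pair_links_mono) blast
  with uv ab have "(u, v) \<in> (pair_links \<pi> (hedges H - {f}))\<^sup>*"
    using sym_rtrancl_sym[OF _ sym_pair_links] by (meson rtrancl_trans subsetD)
  then show False using assms(1,2,3) uv(1) unfolding acyc_def by blast
qed

lemma forest_star_iff:
  assumes "three_hypergraph H" "quasigraph H \<pi>"
  shows "forest (star H \<pi>) \<longleftrightarrow> acyc H \<pi>"
proof
  assume F: "forest (star H \<pi>)"
  show "acyc H \<pi>"
    unfolding acyc_def
  proof (intro ballI allI impI notI)
    fix e a b
    assume e: "e \<in> hedges H" "\<pi> e = {a, b}" and ab: "(a, b) \<in> (pair_links \<pi> (hedges H - {e}))\<^sup>*"
    let ?G = "star H \<pi>" and ?F = "used H \<pi> - {e}"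
    have sub: "\<pi> f \<subseteq> verts H" if "f \<in> hedges H" for f
      using assms that unfolding three_hypergraph_def quasigraph_def by blast
    have ne: "a \<noteq> b" using assms(2) e unfolding quasigraph_def by fastforce
    have "pair_links \<pi> (hedges H - {e}) \<subseteq>
        {(x, y). y \<in> verts ?G \<and> (\<exists>e\<in>?F. ends ?G e = {x, y})}"
      using sub unfolding pair_links_def star_def used_def by fastforce
    with ab have "(a, b) \<in> {(x, y). y \<in> verts ?G \<and> (\<exists>e\<in>?F. ends ?G e = {x, y})}\<^sup>*"
      using rtrancl_mono by blast
    moreover have "a \<in> verts ?G" using sub[OF e(1)] e(2) by (auto simp: star_def)
    ultimately obtain vs es where p: "graph_path ?G vs es" "hd vs = a" "last vs = b" "set es \<subseteq> ?F"
      using rtrancl_graph_path[of a b ?G ?F] by (auto simp: star_def)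
    have len: "length vs = Suc (length es)" and d: "distinct vs"
      and ends: "\<And>i. i < length es \<Longrightarrow> \<pi> (es ! i) = {vs ! i, vs ! Suc i}"
      using p(1) by (auto simp: graph_path_def star_def)
    have "vs \<noteq> []" using len by auto
    have "es \<noteq> []"
    proof
      assume "es = []"
      then have "vs = [hd vs]" using len by (cases vs) auto
      then show False using p ne by (metis last.simps)
    qed
    \<comment> \<open>An edge at positions i < j would make \<open>vs ! i\<close> equal to one of
      the later vertices \<open>vs ! j\<close> and \<open>vs ! Suc j\<close>.\<close>
    have "distinct es"
    proof (rule ccontr)
      assume "\<not> distinct es"
      then obtain i j where ij: "i < j" "j < length es" "es ! i = es ! j"
        by (auto simp: distinct_conv_nth) (metis linorder_neqE_nat)
      then have "{vs ! i, vs ! Suc i} = {vs ! j, vs ! Suc j}"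
        using ends[of i] ends[of j] by simp
      then have "vs ! i = vs ! j \<or> vs ! i = vs ! Suc j" by (auto simp: doubleton_eq_iff)
      then show False
        using d ij len by (auto simp: nth_eq_iff_index_eq)
    qed
    have "graph_cycle ?G vs (es @ [e])"
      unfolding graph_cycle_def
    proof (intro conjI allI impI)
      show "2 \<le> length (es @ [e])" using \<open>es \<noteq> []\<close> by (cases es) auto
      show "distinct (es @ [e])" using \<open>distinct es\<close> p(4) by auto
      show "set (es @ [e]) \<subseteq> hedges ?G" using p(4) e by (auto simp: star_def used_def)
      show "set vs \<subseteq> verts ?G" using p(1) by (auto simp: graph_path_def)
      fix i assume i: "i < length (es @ [e])"
      show "ends ?G ((es @ [e]) ! i) = {vs ! i, vs ! (Suc i mod length vs)}"
      proof (cases "i = length es")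
        case True
        then show ?thesis
          using e(2) p(2,3) len \<open>vs \<noteq> []\<close>
          by (auto simp: star_def hd_conv_nth last_conv_nth)
      next
        case False
        then show ?thesis using i ends[of i] len by (auto simp: star_def nth_append)
      qed
    qed (use len d in auto)
    then show False using F unfolding forest_def by blast
  qed
next
  assume A: "acyc H \<pi>"
  have "multigraph (star H \<pi>)"
    using assms unfolding multigraph_def star_def used_def quasigraph_def three_hypergraph_def
    by fastforce
  moreover have "\<not> graph_cycle (star H \<pi>) vs es" for vs es
  proof
    assume "graph_cycle (star H \<pi>) vs es"
    then have c: "length vs = length es" "2 \<le> length es" "distinct es" "set es \<subseteq> hedges H"
      "\<And>i. i < length es \<Longrightarrow> \<pi> (es ! i) = {vs ! i, vs ! (Suc i mod length es)}"
      unfolding graph_cycle_def star_def used_def by auto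
    have "(vs ! (Suc 0 mod length es), vs ! 0) \<in> (pair_links \<pi> (hedges H - {es ! 0}))\<^sup>*"
    proof (rule around_cycle)
      fix i assume i: "i < length es" "i \<noteq> 0"
      then have "es ! i \<in> hedges H - {es ! 0}"
        using c(2,4) nth_eq_iff_index_eq[OF c(3), of i 0] by (cases "es = []") auto
      then show "(vs ! i, vs ! (Suc i mod length es)) \<in> pair_links \<pi> (hedges H - {es ! 0})"
        using c(5)[OF i(1)] unfolding pair_links_def by blast
    qed (use c(2) in auto)
    moreover have "es ! 0 \<in> hedges H" using c(2) subsetD[OF c(4) nth_mem[of 0 es]] by (cases es) auto
    moreover have "\<pi> (es ! 0) = {vs ! (Suc 0 mod length es), vs ! 0}"
      using c(2) c(5)[of 0] by (cases es) (auto simp: insert_commute)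
    ultimately show False using A unfolding acyc_def by blast
  qed
  ultimately show "forest (star H \<pi>)" unfolding forest_def by blast
qed

section \<open>The exchange step\<close>

text \<open>Larger is better. The third component counts the hyperedges that are not used, crossing and
  of size 3; it makes a switch at a bad leaf an improvement.\<close>
definition score :: "('v, 'e) hypergraph \<Rightarrow> ('e \<Rightarrow> 'v set) \<Rightarrow> nat \<Rightarrow> nat \<times> nat \<times> nat" where
  "score H \<pi> n = (card (conn_lv H \<pi> n), card (anti_lv H \<pi> (Suc n)),
     card {e \<in> hedges H. card (ends H e) = 3 \<longrightarrow> \<pi> e \<times> \<pi> e \<subseteq> anti_lv H \<pi> (Suc n)})"

text \<open>Infinite sequences are compared, so no number of stages has to be fixed in advance. This
  order is not well-founded by itself; maxima will come from the finiteness of the set of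
  configurations.\<close>

definition lex_less :: "(nat \<Rightarrow> 'a::linorder) \<Rightarrow> (nat \<Rightarrow> 'a) \<Rightarrow> bool" where
  "lex_less f g \<longleftrightarrow> (\<exists>m. (\<forall>l<m. f l = g l) \<and> f m < g m)"

text \<open>Fixing the value outside \<open>hedges\<close> leaves only finitely many functions \<pi>
  for one hypergraph.\<close>

definition admissible :: "('v, 'e) hypergraph \<Rightarrow> ('e \<Rightarrow> 'v set) \<Rightarrow> bool" where
  "admissible H \<pi> \<longleftrightarrow> quasigraph H \<pi> \<and> acyc H \<pi> \<and> (\<forall>e. e \<notin> hedges H \<longrightarrow> \<pi> e = {})"

section \<open>Comparing scores and sequences of partitions\<close>

lemma finite_levels:
  assumes "three_hypergraph H"
  shows "finite (anti_lv H \<pi> n)" "finite (conn_lv H \<pi> n)"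
proof -
  have "finite (verts H \<times> verts H)" using assms by (simp add: three_hypergraph_def)
  then show "finite (anti_lv H \<pi> n)" "finite (conn_lv H \<pi> n)"
    using equiv_levels[of H \<pi> n] unfolding equiv_def by (meson finite_subset)+
qed

lemma score_less:
  assumes "three_hypergraph H'"
    and "conn_lv H \<pi> n \<subset> conn_lv H' \<rho> n \<or>
      conn_lv H \<pi> n = conn_lv H' \<rho> n \<and> anti_lv H \<pi> (Suc n) \<subset> anti_lv H' \<rho> (Suc n)"
  shows "score H \<pi> n < score H' \<rho> n"
  using assms(2)
proof
  assume "conn_lv H \<pi> n \<subset> conn_lv H' \<rho> n"
  then have "card (conn_lv H \<pi> n) < card (conn_lv H' \<rho> n)"
    by (intro psubset_card_mono finite_levels(2) assms(1))
  then show ?thesis by (simp add: score_def)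
next
  assume *: "conn_lv H \<pi> n = conn_lv H' \<rho> n \<and> anti_lv H \<pi> (Suc n) \<subset> anti_lv H' \<rho> (Suc n)"
  then have "card (anti_lv H \<pi> (Suc n)) < card (anti_lv H' \<rho> (Suc n))"
    by (intro psubset_card_mono finite_levels(1) assms(1)) simp
  with * show ?thesis by (simp add: score_def)
qed

lemma conn_rel_change:
  assumes "E \<subseteq> E'" "Q \<subseteq> Q'"
    and "\<And>g. g \<in> E \<Longrightarrow> \<pi> g \<noteq> \<rho> g \<Longrightarrow> \<pi> g \<times> \<pi> g \<subseteq> conn_rel \<rho> E' Q'"
  shows "conn_rel \<pi> E Q \<subseteq> conn_rel \<rho> E' Q'"
proof (rule conn_rel_subsetI[OF assms(2)], rule subrelI)
  fix x y assume "(x, y) \<in> Q \<inter> pair_links \<pi> E"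
  then obtain f where f: "(x, y) \<in> Q" "f \<in> E" "\<pi> f = {x, y}" unfolding pair_links_def by blast
  show "(x, y) \<in> conn_rel \<rho> E' Q'"
  proof (cases "\<pi> f = \<rho> f")
    case True
    then show ?thesis using f assms(1,2) by (intro conn_relI[of _ _ _ f]) auto
  next
    case False
    then show ?thesis using assms(3)[OF f(2)] f(3) by blast
  qed
qed

lemma discards_cong:
  assumes "\<And>g. \<pi> g \<times> \<pi> g \<subseteq> P \<longleftrightarrow> \<rho> g \<times> \<rho> g \<subseteq> P"
  shows "discards H \<pi> P S = discards H \<rho> P S"
proof -
  have "free_links N \<pi> E Q P = free_links N \<rho> E Q P" for N E Q
    unfolding free_links_def by (simp add: assms)
  then show ?thesis unfolding discards_def by (simp add: assms)
qed

text \<open>A change of \<pi> inside the classes of level \<open>k\<close> is invisible to the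
  stages before \<open>k\<close> if every lost pair stays connected (\<open>old\<close>) and every
  new pair stays anticonnected (\<open>new\<close>). Discards and the third score component see
  \<pi>(g) only through the question whether it lies in one class, and classes of level
  \<open>k\<close> lie in classes of all earlier levels.\<close>

lemma levels_eq:
  assumes inside: "\<forall>g. \<pi> g \<noteq> \<rho> g \<longrightarrow> \<pi> g \<times> \<pi> g \<subseteq> anti_lv H \<pi> k \<and> \<rho> g \<times> \<rho> g \<subseteq> anti_lv H \<pi> k"
    and old: "\<forall>g j. \<pi> g \<noteq> \<rho> g \<longrightarrow> j < k \<longrightarrow> \<pi> g \<times> \<pi> g \<subseteq> conn_rel \<rho> (live H \<pi> j) (anti_lv H \<pi> j)"
    and new: "\<forall>g j. \<pi> g \<noteq> \<rho> g \<longrightarrow> j < k \<longrightarrow>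
      \<rho> g \<times> \<rho> g \<subseteq> anti_rel (ends H) \<rho> (live H \<pi> j) (conn_lv H \<pi> j)"
  shows "j \<le> k \<Longrightarrow> anti_lv H \<rho> j = anti_lv H \<pi> j"
    and "j \<le> k \<Longrightarrow> live H \<rho> j = live H \<pi> j"
    and "j < k \<Longrightarrow> conn_lv H \<rho> j = conn_lv H \<pi> j"
    and "j < k \<Longrightarrow> score H \<rho> j = score H \<pi> j"
proof -
  note S1 = inside[rule_format] and S2 = old[rule_format] and S3 = new[rule_format]
  have conn: "conn_rel \<rho> (live H \<pi> j) (anti_lv H \<pi> j) = conn_lv H \<pi> j" if "j < k" for j
  proof
    have "\<pi> g \<times> \<pi> g \<subseteq> conn_lv H \<pi> j" "\<rho> g \<times> \<rho> g \<subseteq> conn_lv H \<pi> j" if "\<pi> g \<noteq> \<rho> g" for g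
      using S1[OF that] anti_lv_subset_conn_lv[OF \<open>j < k\<close>] by blast+
    then show "conn_rel \<rho> (live H \<pi> j) (anti_lv H \<pi> j) \<subseteq> conn_lv H \<pi> j"
      unfolding conn_lv_def by (intro conn_rel_change) auto
    show "conn_lv H \<pi> j \<subseteq> conn_rel \<rho> (live H \<pi> j) (anti_lv H \<pi> j)"
      using S2 that unfolding conn_lv_def by (intro conn_rel_change) auto
  qed
  have anti: "anti_rel (ends H) \<rho> (live H \<pi> j) (conn_lv H \<pi> j) = anti_lv H \<pi> (Suc j)"
    if "j < k" for j
  proof
    have "anti_lv H \<pi> k \<subseteq> anti_lv H \<pi> (Suc j)" using that by (intro anti_lv_antimono) simp
    then show "anti_rel (ends H) \<rho> (live H \<pi> j) (conn_lv H \<pi> j) \<subseteq> anti_lv H \<pi> (Suc j)"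
      using S1 unfolding anti_lv_Suc
      by (intro anti_rel_mono[OF equiv_levels(2) equiv_levels(2)]) (auto, metis SigmaI subsetD)
    show "anti_lv H \<pi> (Suc j) \<subseteq> anti_rel (ends H) \<rho> (live H \<pi> j) (conn_lv H \<pi> j)"
      using S3 that unfolding anti_lv_Suc
      by (intro anti_rel_mono[OF equiv_levels(2) equiv_levels(2)]) (auto, metis SigmaI subsetD)
  qed
  have both: "\<pi> g \<times> \<pi> g \<subseteq> anti_lv H \<pi> j \<longleftrightarrow> \<rho> g \<times> \<rho> g \<subseteq> anti_lv H \<pi> j" if "j \<le> k" for g j
    using S1[of g] anti_lv_antimono[OF that, of H \<pi>] by (metis subset_trans)
  have main: "anti_lv H \<rho> j = anti_lv H \<pi> j \<and> live H \<rho> j = live H \<pi> j \<and> hist H \<rho> j = hist H \<pi> j"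
    if "j \<le> k" for j
    using that
  proof (induction j)
    case 0
    show ?case by (simp add: hist_def)
  next
    case (Suc j)
    then have IH: "anti_lv H \<rho> j = anti_lv H \<pi> j" "live H \<rho> j = live H \<pi> j"
      "hist H \<rho> j = hist H \<pi> j" and j: "j < k" by auto
    have c: "conn_lv H \<rho> j = conn_lv H \<pi> j"
      using conn[OF j] IH by (simp add: conn_lv_def)
    have a: "anti_lv H \<rho> (Suc j) = anti_lv H \<pi> (Suc j)"
      using anti[OF j] IH c by (simp add: anti_lv_Suc)
    have h: "hist H \<rho> (Suc j) = hist H \<pi> (Suc j)"
      using IH c by (simp add: hist_Suc)
    have "discards H \<rho> (anti_lv H \<pi> (Suc j)) S = discards H \<pi> (anti_lv H \<pi> (Suc j)) S" for S
      using both[OF Suc.prems] by (intro discards_cong) blast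
    then show ?case using a h IH by (simp add: live_Suc)
  qed
  then show "j \<le> k \<Longrightarrow> anti_lv H \<rho> j = anti_lv H \<pi> j" "j \<le> k \<Longrightarrow> live H \<rho> j = live H \<pi> j"
    by blast+
  show c: "conn_lv H \<rho> j = conn_lv H \<pi> j" if "j < k"
    using conn[OF that] main[of j] that by (simp add: conn_lv_def)
  show "score H \<rho> j = score H \<pi> j" if "j < k"
  proof -
    have "anti_lv H \<rho> (Suc j) = anti_lv H \<pi> (Suc j)" using main[of "Suc j"] that by simp
    then show ?thesis using c[OF that] both[of "Suc j"] that by (simp add: score_def)
  qed
qed

text \<open>The exchange step: the free hyperedge \<open>e\<close> is used to connect two components, although
  \<open>a\<close> and \<open>b\<close> stay anticonnected without it. If this closes a cycle in $\pi^*$, then some other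
  hyperedge \<open>f\<close> of the cycle is released; either \<open>f\<close> merges two anticomponents of an earlier
  stage, or \<open>f\<close> was discarded at an earlier stage and can now itself play the role of \<open>e\<close>.\<close>
lemma improvement:
  assumes H: "three_hypergraph H"
  shows "\<lbrakk>admissible H \<pi>; e \<in> live H \<pi> i; \<pi> e = {}; a \<in> ends H e; b \<in> ends H e;
    (a, b) \<in> anti_rel (ends H) \<pi> (live H \<pi> i - {e}) (anti_lv H \<pi> i); (a, b) \<notin> conn_lv H \<pi> i\<rbrakk> \<Longrightarrow>
    \<exists>\<rho> m. admissible H \<rho> \<and> m \<le> i \<and> (\<forall>l<m. score H \<rho> l = score H \<pi> l) \<and> score H \<pi> m < score H \<rho> m"
proof (induction i arbitrary: \<pi> e a b rule: less_induct)
  case (less i)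
  note adm = \<open>admissible H \<pi>\<close>
  let ?N = "ends H"
  have e: "e \<in> hedges H" using less.prems(2) live_subset_hedges[of H \<pi> i] by blast
  have abi: "(a, b) \<in> anti_lv H \<pi> i"
    using less.prems(6) anti_rel_subset[OF equiv_levels(1), of ?N \<pi> _ H \<pi> i] by blast
  have ne: "a \<noteq> b"
    using abi less.prems(7) equiv_levels[of H \<pi> i] by (auto simp: equiv_def refl_on_def)
  have ablv: "(a, b) \<in> anti_lv H \<pi> j" if "j \<le> i" for j
    using abi anti_lv_antimono[OF that, of H \<pi>] by blast
  have elv: "e \<in> live H \<pi> j" if "j \<le> i" for j
    using less.prems(2) live_antimono[OF that, of H \<pi>] by blast
  \<comment> \<open>The hypothesis on \<open>a\<close> and \<open>b\<close> leaves \<open>e\<close>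
    out, and shrinking the other values only makes hyperedges freer; so \<open>a\<close> and
    \<open>b\<close> stay anticonnected after each of the changes below.\<close>
  have ab_anti: "(a, b) \<in> anti_rel ?N \<rho> E C"
    if "\<And>g. g \<noteq> e \<Longrightarrow> \<rho> g \<subseteq> \<pi> g" "live H \<pi> i - {e} \<subseteq> E" "anti_lv H \<pi> i \<subseteq> C" "equiv (verts H) C"
    for \<rho> E C
  proof -
    have "anti_rel ?N \<pi> (live H \<pi> i - {e}) (anti_lv H \<pi> i) \<subseteq> anti_rel ?N \<rho> E C"
      using that(1)
      by (intro anti_rel_mono[OF equiv_levels(1) that(4,2,3)]) (metis DiffD2 Sigma_mono singletonI subset_trans)
    then show ?thesis using less.prems(6) by blast
  qed
  have ab_anti_lv: "{a, b} \<times> {a, b} \<subseteq> anti_rel ?N \<rho> (live H \<pi> j) (conn_lv H \<pi> j)"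
    if "\<And>g. g \<noteq> e \<Longrightarrow> \<rho> g \<subseteq> \<pi> g" "j < i" for \<rho> j
  proof -
    have "(a, b) \<in> anti_rel ?N \<rho> (live H \<pi> j) (conn_lv H \<pi> j)"
      using that live_antimono[of j i H \<pi>] anti_lv_subset_conn_lv[OF that(2), of H \<pi>]
      by (intro ab_anti equiv_levels) auto
    then show ?thesis by (rule equiv_pair[OF equiv_anti_rel[OF equiv_levels(2)]])
  qed
  have quasi_e: "{a, b} \<subseteq> ?N e" "card {a, b} = 2"
    using less.prems(4,5) ne by auto
  show ?case
  \<comment> \<open>Does the pair {a, b} close a cycle of \<pi>*? If not, it is simply added, and
    stage \<open>i\<close> gains a connection.\<close>
  proof (cases "(a, b) \<in> (pair_links \<pi> (hedges H))\<^sup>*")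
    case False
    define \<rho> where "\<rho> = \<pi>(e := {a, b})"
    have adm_rho: "admissible H \<rho>"
      using adm acyc_insert[OF _ e less.prems(3) False] quasi_e e
      unfolding admissible_def \<rho>_def quasigraph_def by auto
    have dif: "\<pi> g \<noteq> \<rho> g \<Longrightarrow> g = e" for g by (auto simp: \<rho>_def split: if_splits)
    have S1: "\<pi> g \<times> \<pi> g \<subseteq> anti_lv H \<pi> i \<and> \<rho> g \<times> \<rho> g \<subseteq> anti_lv H \<pi> i" if "\<pi> g \<noteq> \<rho> g" for g
      using dif[OF that] less.prems(3) equiv_pair[OF equiv_levels(1) abi] by (simp add: \<rho>_def)
    have S2: "\<pi> g \<times> \<pi> g \<subseteq> conn_rel \<rho> E Q" if "\<pi> g \<noteq> \<rho> g" for g E Q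
      using dif[OF that] less.prems(3) by simp
    have S3: "\<rho> g \<times> \<rho> g \<subseteq> anti_rel ?N \<rho> (live H \<pi> j) (conn_lv H \<pi> j)" if "\<pi> g \<noteq> \<rho> g" "j < i" for g j
      using dif[OF that(1)] ab_anti_lv[of \<rho> j] that(2) by (simp add: \<rho>_def)
    have eqs: "anti_lv H \<rho> i = anti_lv H \<pi> i" "live H \<rho> i = live H \<pi> i"
      "\<And>l. l < i \<Longrightarrow> score H \<rho> l = score H \<pi> l"
      by (rule levels_eq[of \<pi> \<rho> H i]; (intro allI impI S1 S2 S3)?; assumption?; simp)+
    have "conn_lv H \<pi> i \<subseteq> conn_lv H \<rho> i"
      unfolding conn_lv_def eqs(1,2) using S2 by (intro conn_rel_change) auto
    moreover have "(a, b) \<in> conn_lv H \<rho> i"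
      unfolding conn_lv_def eqs(1,2) using abi less.prems(2)
      by (intro conn_relI[of _ _ _ e]) (auto simp: \<rho>_def)
    ultimately have "conn_lv H \<pi> i \<subset> conn_lv H \<rho> i" using less.prems(7) by blast
    then have "score H \<pi> i < score H \<rho> i" by (intro score_less[OF H]) blast
    with adm_rho eqs(3) show ?thesis by blast
  next
    case True
    have "finite (hedges H)" using H by (simp add: three_hypergraph_def)
    from minimal_connection[OF this True] obtain F where F_props: "F \<subseteq> hedges H"
      "(a, b) \<in> (pair_links \<pi> F)\<^sup>*" "\<forall>f\<in>F. (a, b) \<notin> (pair_links \<pi> (F - {f}))\<^sup>*" .
    note F = F_props(1,2) F_props(3)[rule_format]
    \<comment> \<open>The path \<open>F\<close> is followed through the stages until it first
      breaks. It cannot be whole at stage \<open>i\<close>, since it would connect \<open>a\<close>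
      and \<open>b\<close> there.\<close>
    define inside where
      "inside m \<longleftrightarrow> (\<forall>f\<in>F. f \<in> live H \<pi> m \<and> \<pi> f \<times> \<pi> f \<subseteq> anti_lv H \<pi> m)" for m
    have "inside 0"
      using F(1) adm H by (auto simp: inside_def admissible_def quasigraph_def three_hypergraph_def) blast+
    moreover have "\<not> inside i"
    proof
      assume "inside i"
      then have "pair_links \<pi> F \<subseteq> anti_lv H \<pi> i \<inter> pair_links \<pi> (live H \<pi> i)"
        unfolding inside_def pair_links_def by blast
      then have "(a, b) \<in> (anti_lv H \<pi> i \<inter> pair_links \<pi> (live H \<pi> i))\<^sup>*"
        using F(2) rtrancl_mono by blast
      then show False
        using abi less.prems(7) unfolding conn_lv_def conn_rel_def by blast
    qed
    ultimately obtain m where m: "m < i" "inside m" "\<not> inside (Suc m)"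
      using ex_least_nat_less[of "\<lambda>m. \<not> inside m" i] by auto
    \<comment> \<open>Any \<open>f\<close> in \<open>F\<close> may be released: the rest of
      \<open>F\<close> and the new pair {a, b} still join its ends, so no stage up to
      \<open>m\<close> loses a connection.\<close>
    have exch: "admissible H (\<pi>(e := {a, b}, f := {}))"
      "f \<noteq> e" "\<pi> f \<times> \<pi> f \<subseteq> conn_rel (\<pi>(e := {a, b}, f := {})) (live H \<pi> m) (anti_lv H \<pi> m)"
      if f: "f \<in> F" for f
    proof -
      define \<rho> where "\<rho> = \<pi>(e := {a, b}, f := {})"
      from connection_split[OF F(2) F(3)[OF f]] obtain u v where uv: "\<pi> f = {u, v}"
        "(a, u) \<in> (pair_links \<pi> (F - {f}))\<^sup>*" "(v, b) \<in> (pair_links \<pi> (F - {f}))\<^sup>*" .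
      show "f \<noteq> e" using uv(1) less.prems(3) by auto
      have "(a, b) \<notin> (pair_links \<pi> (hedges H - {f}))\<^sup>*"
        using acyc_connection_unique[OF _ F(1) f F(2) F(3)[OF f]] adm by (simp add: admissible_def)
      moreover have "pair_links (\<pi>(f := {})) (hedges H) = pair_links \<pi> (hedges H - {f})"
        unfolding pair_links_def by auto
      ultimately have "acyc H ((\<pi>(f := {}))(e := {a, b}))"
        using adm e less.prems(3) \<open>f \<noteq> e\<close>
        by (intro acyc_insert acyc_remove) (auto simp: admissible_def)
      then show "admissible H (\<pi>(e := {a, b}, f := {}))"
        using adm quasi_e e \<open>f \<noteq> e\<close> unfolding admissible_def quasigraph_def
        by (auto simp: fun_upd_twist)
      let ?L = "anti_lv H \<pi> m \<inter> pair_links \<rho> (live H \<pi> m)"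
      have symL: "sym ?L"
        using equiv_levels(1)[of H \<pi> m] by (intro sym_Int sym_pair_links) (simp add: equiv_def)
      have "e \<notin> F"
      proof
        assume "e \<in> F"
        from connection_split[OF F(2) F(3)[OF this]] show False using less.prems(3) by auto
      qed
      then have "pair_links \<pi> (F - {f}) \<subseteq> ?L"
        using m(2) unfolding inside_def pair_links_def \<rho>_def by fastforce
      then have "(a, u) \<in> ?L\<^sup>*" "(v, b) \<in> ?L\<^sup>*"
        using uv rtrancl_mono by blast+
      moreover have "(a, b) \<in> ?L"
        using ablv[of m] elv[of m] m(1) \<open>f \<noteq> e\<close> by (auto simp: pair_links_def \<rho>_def)
      ultimately have "(u, v) \<in> ?L\<^sup>*"
        using sym_rtrancl_sym[OF _ symL] by (meson r_into_rtrancl rtrancl_trans)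
      moreover have "(u, v) \<in> anti_lv H \<pi> m"
        using m(2) f uv(1) unfolding inside_def by blast
      ultimately have "(u, v) \<in> conn_rel \<rho> (live H \<pi> m) (anti_lv H \<pi> m)"
        unfolding conn_rel_def by blast
      then show "\<pi> f \<times> \<pi> f \<subseteq> conn_rel (\<pi>(e := {a, b}, f := {})) (live H \<pi> m) (anti_lv H \<pi> m)"
        unfolding uv(1) \<rho>_def by (rule equiv_pair[OF equiv_conn_rel[OF equiv_levels(1)]])
    qed
    have S2: "\<pi> g \<times> \<pi> g \<subseteq> conn_rel (\<pi>(e := {a, b}, f := {})) (live H \<pi> j) (anti_lv H \<pi> j)"
      if "f \<in> F" "\<pi> g \<noteq> (\<pi>(e := {a, b}, f := {})) g" "j \<le> m" for f g j
    proof (cases "g = f")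
      case True
      have "conn_rel (\<pi>(e := {a, b}, f := {})) (live H \<pi> m) (anti_lv H \<pi> m) \<subseteq>
          conn_rel (\<pi>(e := {a, b}, f := {})) (live H \<pi> j) (anti_lv H \<pi> j)"
        by (intro conn_rel_mono anti_lv_antimono live_antimono that(3))
      then show ?thesis using True exch(3)[OF that(1)] by blast
    next
      case False
      then have "g = e" using that(2) by (auto split: if_splits)
      then show ?thesis using less.prems(3) by simp
    qed
    have S3: "(\<pi>(e := {a, b}, f := {})) g \<times> (\<pi>(e := {a, b}, f := {})) g \<subseteq>
        anti_rel ?N (\<pi>(e := {a, b}, f := {})) (live H \<pi> j) (conn_lv H \<pi> j)"
      if "f \<in> F" "\<pi> g \<noteq> (\<pi>(e := {a, b}, f := {})) g" "j \<le> m" for f g j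
    proof (cases "g = e")
      case True
      then show ?thesis
        using ab_anti_lv[of "\<pi>(e := {a, b}, f := {})" j] m(1) that(3) exch(2)[OF that(1)] by auto
    next
      case False
      then have "g = f" using that(2) by (auto split: if_splits)
      then show ?thesis by simp
    qed
    have S1: "\<pi> g \<times> \<pi> g \<subseteq> anti_lv H \<pi> k \<and>
        (\<pi>(e := {a, b}, f := {})) g \<times> (\<pi>(e := {a, b}, f := {})) g \<subseteq> anti_lv H \<pi> k"
      if "f \<in> F" "\<pi> f \<times> \<pi> f \<subseteq> anti_lv H \<pi> k" "k \<le> i" "\<pi> g \<noteq> (\<pi>(e := {a, b}, f := {})) g" for f g k
      using that(2,4) less.prems(3) exch(2)[OF that(1)] equiv_pair[OF equiv_levels(1) ablv[OF that(3)]]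
      by (cases "g = f") (auto split: if_splits)
    consider (split) f where "f \<in> F" "\<not> \<pi> f \<times> \<pi> f \<subseteq> anti_lv H \<pi> (Suc m)"
      | (discarded) f where "f \<in> F" "\<pi> f \<times> \<pi> f \<subseteq> anti_lv H \<pi> (Suc m)" "f \<notin> live H \<pi> (Suc m)"
      using m(3) unfolding inside_def by blast
    then show ?thesis
    proof cases
      case split
      note f = \<open>f \<in> F\<close>
      define \<rho> where "\<rho> = \<pi>(e := {a, b}, f := {})"
      have fin: "f \<in> live H \<pi> m" "\<pi> f \<times> \<pi> f \<subseteq> anti_lv H \<pi> m"
        using m(2) f by (auto simp: inside_def)
      note S = S1[OF f fin(2) less_imp_le[OF m(1)], folded \<rho>_def] S2[OF f, folded \<rho>_def]
        S3[OF f, folded \<rho>_def]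
      have eqm: "anti_lv H \<rho> m = anti_lv H \<pi> m" "live H \<rho> m = live H \<pi> m"
        and eqs: "\<And>l. l < m \<Longrightarrow> score H \<rho> l = score H \<pi> l"
        by (rule levels_eq[of \<pi> \<rho> H m]; (intro allI impI S)?; assumption?; simp)+
      have sub: "conn_lv H \<pi> m \<subseteq> conn_lv H \<rho> m"
        unfolding conn_lv_def eqm using S(2) by (intro conn_rel_change) auto
      \<comment> \<open>If the components do not grow, the released \<open>f\<close> is free and
        merges its own former ends, which level \<open>Suc m\<close> had separated.\<close>
      have "anti_lv H \<pi> (Suc m) \<subset> anti_lv H \<rho> (Suc m)" if eq: "conn_lv H \<pi> m = conn_lv H \<rho> m"
      proof
        show "anti_lv H \<pi> (Suc m) \<subseteq> anti_lv H \<rho> (Suc m)"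
          unfolding anti_lv_Suc eqm eq[symmetric] using S(3)
          by (intro anti_rel_mono[OF equiv_levels(2) equiv_levels(2)]) (auto, metis SigmaI subsetD order_refl)
        obtain u v where uv: "u \<in> \<pi> f" "v \<in> \<pi> f" "(u, v) \<notin> anti_lv H \<pi> (Suc m)" using split(2) by auto
        have q: "\<pi> f \<subseteq> ?N f" "card (\<pi> f) = 2"
          using adm F(1) f uv unfolding admissible_def quasigraph_def by blast+
        have "u \<noteq> v"
        proof
          assume "u = v"
          moreover have "u \<in> verts H" using q uv F(1) f H unfolding three_hypergraph_def by blast
          ultimately show False
            using uv equiv_levels(1)[of H \<pi> "Suc m"] by (auto simp: equiv_def refl_on_def)
        qed
        then have "\<pi> f = {u, v}"
          using uv q by (metis card_2_iff insertE insert_commute singletonD)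
        then have "(u, v) \<in> conn_lv H \<pi> m"
          unfolding conn_lv_def using fin by (intro conn_relI[of _ _ _ f]) auto
        then have "(u, v) \<in> anti_lv H \<rho> (Suc m)"
          unfolding anti_lv_Suc eqm eq[symmetric] using fin uv q
          by (intro anti_rel_edgeI[of f]) (auto simp: \<rho>_def)
        then show "anti_lv H \<pi> (Suc m) \<noteq> anti_lv H \<rho> (Suc m)" using uv by blast
      qed
      with sub have "score H \<pi> m < score H \<rho> m" by (intro score_less[OF H]) blast
      then show ?thesis
        using exch(1)[OF f, folded \<rho>_def] eqs m(1) by (meson less_imp_le)
    next
      case discarded
      note f = \<open>f \<in> F\<close>
      define \<rho> where "\<rho> = \<pi>(e := {a, b}, f := {})"
      note S = S1[OF f discarded(2) Suc_leI[OF m(1)], folded \<rho>_def] S2[OF f, folded \<rho>_def]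
        S3[OF f, folded \<rho>_def]
      have eqs: "j \<le> Suc m \<Longrightarrow> anti_lv H \<rho> j = anti_lv H \<pi> j"
        "j \<le> Suc m \<Longrightarrow> live H \<rho> j = live H \<pi> j"
        "j < Suc m \<Longrightarrow> conn_lv H \<rho> j = conn_lv H \<pi> j"
        "j < Suc m \<Longrightarrow> score H \<rho> j = score H \<pi> j" for j
        by (rule levels_eq[of \<pi> \<rho> H "Suc m" j]; (intro allI impI S)?; assumption?; simp)+
      let ?P = "anti_lv H \<pi> (Suc m)"
      have fm: "f \<in> live H \<pi> m" using m(2) f by (auto simp: inside_def)
      then have "f \<in> discards H \<pi> ?P (hist H \<pi> (Suc m))"
        using discarded(3) by (simp add: live_Suc)
      then obtain x x' z i1 where w: "?N f = {x, x', z}" "(x, x') \<in> ?P" "(x, z) \<notin> ?P"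
        and i1: "i1 \<le> m" "(x, z) \<in> anti_lv H \<pi> i1" "(x, z) \<notin> conn_lv H \<pi> i1"
        and lk: "(x, z) \<in> (free_links ?N \<pi> (live H \<pi> i1 - {f}) (anti_lv H \<pi> i1) ?P)\<^sup>*"
        by (elim discards_histE)
      have fe: "f \<noteq> e" by (rule exch(2)[OF f])
      have rho: "\<rho> f = {}" "\<rho> e = {a, b}" "\<And>g. g \<noteq> e \<Longrightarrow> \<rho> g \<subseteq> \<pi> g" "\<And>g. g \<noteq> e \<Longrightarrow> g \<noteq> f \<Longrightarrow> \<rho> g = \<pi> g"
        using fe by (auto simp: \<rho>_def)
      let ?A = "anti_rel ?N \<rho> (live H \<pi> i1 - {f}) (anti_lv H \<pi> i1)"
      have eqA: "equiv (verts H) ?A" by (rule equiv_anti_rel[OF equiv_levels(1)])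
      note i1m = i1(1)
      have "live H \<pi> i \<subseteq> live H \<pi> (Suc m)" using m(1) by (intro live_antimono) simp
      then have "live H \<pi> i - {e} \<subseteq> live H \<pi> i1 - {f}"
        using live_antimono[of i1 i H \<pi>] i1m m(1) discarded(3) by auto
      then have "(a, b) \<in> ?A"
        using rho(3) anti_lv_antimono[of i1 i H \<pi>] i1m m(1)
        by (intro ab_anti equiv_levels) auto
      then have abA: "{a, b} \<times> {a, b} \<subseteq> ?A" by (rule equiv_pair[OF eqA])
      have "?P \<subseteq> ?A"
        unfolding anti_lv_Suc[of H \<pi> m]
      proof (rule anti_rel_subsetI[OF eqA equiv_levels(2)])
        fix g p q
        assume g: "g \<in> live H \<pi> m" "\<pi> g \<times> \<pi> g \<subseteq> ?A" "p \<in> ?N g" "q \<in> ?N g" "(p, q) \<in> conn_lv H \<pi> m"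
          "(p, q) \<in> anti_rel ?N \<pi> (live H \<pi> m) (conn_lv H \<pi> m)"
        then have pq: "(p, q) \<in> ?P" by (simp add: anti_lv_Suc)
        have pqi: "(p, q) \<in> anti_lv H \<pi> i1"
          using pq anti_lv_antimono[of i1 "Suc m" H \<pi>] i1m by auto
        show "(p, q) \<in> ?A"
        \<comment> \<open>Inside \<open>?P\<close> the hyperedge \<open>f\<close> can merge only x
          and x'. But \<pi>(f) is this very pair and has to be merged before \<open>f\<close> acts,
          so \<open>f\<close> contributes nothing to \<open>?P\<close>.\<close>
        proof (cases "g = f")
          case True
          show ?thesis
          proof (cases "p = q")
            case True
            then show ?thesis using pqi anti_rel.refl by metis
          next
            case False
            have 1: "{p, q} = {x, x'}"
              using related_pair_of_triple[OF equiv_levels(1) w(2,3) _ _ pq False] g True w(1) by auto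
            have "\<pi> f \<noteq> {}"
              using connection_split[OF F(2) F(3)[OF f]] by (metis insert_not_empty)
            then have "\<pi> f \<subseteq> ?N f" "card (\<pi> f) = 2"
              using adm F(1) f unfolding admissible_def quasigraph_def by blast+
            then obtain u v where uv: "\<pi> f = {u, v}" "u \<noteq> v" "u \<in> ?N f" "v \<in> ?N f"
              by (metis card_2_iff insert_subset)
            then have "(u, v) \<in> ?P" using discarded(2) by auto
            then have "{u, v} = {x, x'}"
              using related_pair_of_triple[OF equiv_levels(1) w(2,3) _ _ _ uv(2)] uv w(1) by auto
            then have "p \<in> \<pi> f" "q \<in> \<pi> f" using 1 uv(1) by blast+
            then show ?thesis using g(2) True by blast
          qed
        next
          case False
          have "\<rho> g \<times> \<rho> g \<subseteq> ?A"
            using g(2) abA rho False by (cases "g = e") auto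
          then show ?thesis
            using g pqi False live_antimono[OF i1m, of H \<pi>] by (intro anti_rel_edgeI[of g]) auto
        qed
      qed
      moreover have "{a, b} \<times> {a, b} \<subseteq> ?P"
        by (rule equiv_pair[OF equiv_levels(1) ablv]) (use m(1) in simp)
      then have "\<rho> g \<times> \<rho> g \<subseteq> ?P" if "\<pi> g \<times> \<pi> g \<subseteq> ?P" for g
        using that rho by (cases "g = e"; cases "g = f") auto
      ultimately have xzA: "(x, z) \<in> ?A"
        using lk i1(2) by (intro free_links_anti_rel[OF equiv_levels(1)]) auto
      have "\<exists>\<sigma> n. admissible H \<sigma> \<and> n \<le> i1 \<and> (\<forall>l<n. score H \<sigma> l = score H \<rho> l) \<and>
          score H \<rho> n < score H \<sigma> n"
      proof (rule less.IH[of i1 \<rho> f x z])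
        show "i1 < i" using i1m m(1) by simp
        show "admissible H \<rho>" unfolding \<rho>_def by (rule exch(1)[OF f])
        have eq1: "anti_lv H \<rho> i1 = anti_lv H \<pi> i1" "live H \<rho> i1 = live H \<pi> i1"
            "conn_lv H \<rho> i1 = conn_lv H \<pi> i1"
          using eqs(1-3)[of i1] i1m by auto
        show "f \<in> live H \<rho> i1" using fm live_antimono[OF i1m, of H \<pi>] eq1 by auto
        show "(x, z) \<in> anti_rel ?N \<rho> (live H \<rho> i1 - {f}) (anti_lv H \<rho> i1)"
          using xzA eq1 by simp
        show "(x, z) \<notin> conn_lv H \<rho> i1" using i1(3) eq1 by simp
      qed (use w rho in auto)
      then obtain \<sigma> n where s: "admissible H \<sigma>" "n \<le> i1" "\<forall>l<n. score H \<sigma> l = score H \<rho> l"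
          "score H \<rho> n < score H \<sigma> n" by blast
      \<comment> \<open>\<sigma> improves \<rho> at some \<open>n \<le> i1 \<le> m\<close>, where
        \<rho> and \<pi> still have equal scores.\<close>
      have "score H \<rho> l = score H \<pi> l" if "l \<le> n" for l
        using eqs(4) that s(2) i1m by auto
      then have "(\<forall>l<n. score H \<sigma> l = score H \<pi> l) \<and> score H \<pi> n < score H \<sigma> n"
        using s by auto
      moreover have "n \<le> i" using s(2) i1m m(1) by simp
      ultimately show ?thesis using s(1) by blast
    qed
  qed
qed

section \<open>Optimal quasigraphs have skeletal partitions\<close>

definition optimal :: "('v, 'e) hypergraph \<Rightarrow> ('e \<Rightarrow> 'v set) \<Rightarrow> bool" where
  "optimal H \<pi> \<longleftrightarrow> admissible H \<pi> \<and>
     (\<forall>\<rho>. admissible H \<rho> \<longrightarrow> \<not> lex_less (score H \<pi>) (score H \<rho>))"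

lemma optimal_no_exchange:
  assumes "three_hypergraph H" "optimal H \<pi>" "e \<in> live H \<pi> i" "\<pi> e = {}"
    "a \<in> ends H e" "b \<in> ends H e"
    "(a, b) \<in> anti_rel (ends H) \<pi> (live H \<pi> i - {e}) (anti_lv H \<pi> i)"
  shows "(a, b) \<in> conn_lv H \<pi> i"
proof (rule ccontr)
  assume "(a, b) \<notin> conn_lv H \<pi> i"
  with improvement[OF assms(1) _ assms(3-7)] assms(2) obtain \<rho> m where
    "admissible H \<rho>" "\<forall>l<m. score H \<rho> l = score H \<pi> l" "score H \<pi> m < score H \<rho> m"
    unfolding optimal_def by blast
  then have "lex_less (score H \<pi>) (score H \<rho>)" unfolding lex_less_def by metis
  with \<open>admissible H \<rho>\<close> assms(2) show False unfolding optimal_def by blast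
qed

text \<open>Stability of \<open>live\<close> is needed besides that of the partition: it says that a
  hyperedge which meets the discard condition for the final partition is already gone at stage
  \<open>n\<close>.\<close>

lemma levels_stabilize:
  assumes "three_hypergraph H"
  obtains n where "anti_lv H \<pi> (Suc n) = anti_lv H \<pi> n" "live H \<pi> (Suc n) = live H \<pi> n"
proof -
  let ?f = "\<lambda>n. card (anti_lv H \<pi> n) + card (live H \<pi> n)"
  have fin: "finite (live H \<pi> n)" for n
    using assms live_subset_hedges[of H \<pi> n] by (meson finite_subset three_hypergraph_def)
  have "\<exists>n. anti_lv H \<pi> (Suc n) = anti_lv H \<pi> n \<and> live H \<pi> (Suc n) = live H \<pi> n"
  proof (rule ccontr)
    assume *: "\<nexists>n. anti_lv H \<pi> (Suc n) = anti_lv H \<pi> n \<and> live H \<pi> (Suc n) = live H \<pi> n"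
    have "?f (Suc n) < ?f n" for n
    proof -
      have sub: "anti_lv H \<pi> (Suc n) \<subseteq> anti_lv H \<pi> n" "live H \<pi> (Suc n) \<subseteq> live H \<pi> n"
        by (auto simp: live_Suc intro!: anti_lv_antimono)
      then have "card (anti_lv H \<pi> (Suc n)) \<le> card (anti_lv H \<pi> n)"
        "card (live H \<pi> (Suc n)) \<le> card (live H \<pi> n)"
        by (auto intro: card_mono finite_levels assms fin)
      moreover have "anti_lv H \<pi> (Suc n) \<subset> anti_lv H \<pi> n \<or> live H \<pi> (Suc n) \<subset> live H \<pi> n"
        using sub * by blast
      then have "card (anti_lv H \<pi> (Suc n)) < card (anti_lv H \<pi> n) \<or>
          card (live H \<pi> (Suc n)) < card (live H \<pi> n)"
        using psubset_card_mono finite_levels(1)[OF assms] fin by metis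
      ultimately show ?thesis by linarith
    qed
    then have "?f n + n \<le> ?f 0" for n
    proof (induction n)
      case (Suc n)
      then show ?case using Suc.prems[of n] by fastforce
    qed simp
    from this[of "Suc (?f 0)"] show False by linarith
  qed
  with that show thesis by blast
qed

lemma unrelated_pair_of_triple:
  assumes Q: "equiv V Q" "A \<subseteq> V" and card: "card A \<in> {2, 3}"
    and ab: "a \<in> A" "b \<in> A" "(a, b) \<notin> Q" and x: "x \<in> A" "x' \<in> A" "x \<noteq> x'" "(x, x') \<in> Q"
  obtains z where "A = {x, x', z}" "card A = 3" "(x, z) \<notin> Q" "{a, b} = {x, z} \<or> {a, b} = {x', z}"
proof -
  have sx: "(x', x) \<in> Q" and refl: "\<And>y. y \<in> A \<Longrightarrow> (y, y) \<in> Q"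
    using Q x unfolding equiv_def refl_on_def by (auto dest: symD)
  have "\<not> {a, b} \<subseteq> {x, x'}"
    using ab x sx refl by auto
  then have ne: "A \<noteq> {x, x'}" using ab by blast
  have fin: "finite A" using card by (auto intro: card_ge_0_finite)
  have "card A \<noteq> 2"
    using ne card_subset_eq[of A "{x, x'}"] fin x by auto
  then have c: "card A = 3" using card by simp
  then have "card (A - {x, x'}) = 1"
    using x fin by (simp add: card_Diff_subset)
  then obtain z where z: "A - {x, x'} = {z}" by (metis card_1_singletonE)
  then have A: "A = {x, x', z}" using x by blast
  have "{a, b} = {x, z} \<or> {a, b} = {x', z}"
    using ab(1,2) ab(3) refl \<open>\<not> {a, b} \<subseteq> {x, x'}\<close> unfolding A by auto
  moreover have "(x, z) \<notin> Q"
  proof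
    assume xz: "(x, z) \<in> Q"
    then have "(x', z) \<in> Q" "(z, x) \<in> Q" "(z, x') \<in> Q"
      using sx x Q unfolding equiv_def by (meson symD transD)+
    with xz calculation ab show False by (auto simp: doubleton_eq_iff)
  qed
  ultimately show thesis using that A c by blast
qed

text \<open>A cycle of free hyperedges \<open>g\<close>, each joining two classes through \<open>a g\<close> and \<open>b g\<close>.
  The first stage at which \<open>G\<close> is torn apart either splits some \<open>g\<close> into two components, and
  \<open>g\<close> can be exchanged; or it discards some \<open>g\<close>, although \<open>g\<close> was exchangeable when
  it was discarded.\<close>
lemma optimal_no_free_cycle:
  assumes H: "three_hypergraph H" and opt: "optimal H \<pi>"
    and stable: "anti_lv H \<pi> (Suc n) = anti_lv H \<pi> n" "live H \<pi> (Suc n) = live H \<pi> n"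
    and G: "G \<subseteq> hedges H" "G \<noteq> {}"
    and ends: "\<And>g. g \<in> G \<Longrightarrow> \<pi> g \<times> \<pi> g \<subseteq> anti_lv H \<pi> n \<and> a g \<in> ends H g \<and> b g \<in> ends H g \<and>
      (a g, b g) \<notin> anti_lv H \<pi> n"
    and cyc: "\<And>e. e \<in> G \<Longrightarrow> (a e, b e) \<in> (anti_lv H \<pi> n \<union>
      {(x, y). \<exists>g\<in>G - {e}. x = a g \<and> y = b g \<or> x = b g \<and> y = a g})\<^sup>*"
  shows False
proof -
  let ?N = "ends H" and ?Q = "anti_lv H \<pi> n"
  let ?W = "\<lambda>e. ?Q \<union> {(x, y). \<exists>g\<in>G - {e}. x = a g \<and> y = b g \<or> x = b g \<and> y = a g}"
  have adm: "admissible H \<pi>" using opt by (simp add: optimal_def)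
  have eqs: "equiv (verts H) (anti_lv H \<pi> i)" "equiv (verts H) (conn_lv H \<pi> i)" for i
    by (rule equiv_levels)+
  have N: "?N g \<subseteq> verts H" "card (?N g) \<in> {2, 3}" if "g \<in> G" for g
    using H G(1) that unfolding three_hypergraph_def by blast+
  have pi: "\<exists>p q. \<pi> g = {p, q} \<and> p \<noteq> q \<and> p \<in> ?N g \<and> q \<in> ?N g" if "g \<in> G" "\<pi> g \<noteq> {}" for g
  proof -
    have "\<pi> g \<subseteq> ?N g" "card (\<pi> g) = 2"
      using adm G(1) that unfolding admissible_def quasigraph_def by blast+
    then show ?thesis by (metis card_2_iff insert_subset)
  qed
  have ne: "a g \<noteq> b g" if "g \<in> G" for g
    using ends[OF that] N[OF that] eqs(1)[of n] unfolding equiv_def refl_on_def by (metis subsetD)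
  have Qconn: "conn_lv H \<pi> n = ?Q"
    using anti_lv_Suc_subset[of H \<pi> n] conn_lv_subset[of H \<pi> n] stable(1) by blast
  have Qanti: "?Q = anti_rel ?N \<pi> (live H \<pi> n) (conn_lv H \<pi> n)"
    using stable(1) by (simp add: anti_lv_Suc)
  define inside where "inside i \<longleftrightarrow> (\<forall>g\<in>G. g \<in> live H \<pi> i \<and> (a g, b g) \<in> anti_lv H \<pi> i)" for i
  have "inside 0"
    unfolding inside_def using ends N G(1) by auto
  moreover have "\<not> inside n" unfolding inside_def using ends G(2) by blast
  ultimately obtain i where i: "i < n" "inside i" "\<not> inside (Suc i)"
    using ex_least_nat_less[of "\<lambda>i. \<not> inside i" n] by auto
  have Qi: "?Q \<subseteq> anti_lv H \<pi> i" "?Q \<subseteq> anti_lv H \<pi> (Suc i)" "?Q \<subseteq> conn_lv H \<pi> i"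
    using i(1) anti_lv_antimono[of _ n H \<pi>] anti_lv_subset_conn_lv[of i n H \<pi>] by auto
  have lv: "live H \<pi> n \<subseteq> live H \<pi> i" "live H \<pi> n \<subseteq> live H \<pi> (Suc i)"
    using i(1) by (auto intro!: live_antimono)
  show False
  proof (cases "\<forall>g\<in>G. (a g, b g) \<in> conn_lv H \<pi> i")
    case False
    then obtain e where e: "e \<in> G" "(a e, b e) \<notin> conn_lv H \<pi> i" by blast
    have abi: "(a e, b e) \<in> anti_lv H \<pi> i" "e \<in> live H \<pi> i" using i(2) e by (auto simp: inside_def)
    have "?W e \<subseteq> free_links ?N \<pi> (live H \<pi> i - {e}) (anti_lv H \<pi> i) ?Q"
    proof (rule subrelI)
      fix x y assume "(x, y) \<in> ?W e"
      then consider "(x, y) \<in> ?Q" | g where "g \<in> G - {e}" "x = a g \<and> y = b g \<or> x = b g \<and> y = a g"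
        by blast
      then show "(x, y) \<in> free_links ?N \<pi> (live H \<pi> i - {e}) (anti_lv H \<pi> i) ?Q"
      proof cases
        case 2
        have "(a g, b g) \<in> anti_lv H \<pi> i" "(b g, a g) \<in> anti_lv H \<pi> i" "g \<in> live H \<pi> i - {e}"
          using i(2) 2(1) eqs(1)[of i] unfolding inside_def equiv_def by (auto dest: symD)
        then show ?thesis using 2 ends[of g] unfolding free_links_def by blast
      qed (simp add: free_links_def)
    qed
    then have fl: "(a e, b e) \<in> (free_links ?N \<pi> (live H \<pi> i - {e}) (anti_lv H \<pi> i) ?Q)\<^sup>*"
      using cyc[OF e(1)] rtrancl_mono by blast
    \<comment> \<open>In both cases \<open>e\<close> is dispensable for \<open>?Q\<close>. If it
      meets a class in two vertices, the walk \<open>fl\<close> makes it satisfy the discard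
      condition, so by stability it is not live; otherwise it meets each class at most once and can
      merge nothing inside \<open>?Q\<close>.\<close>
    have "\<pi> e = {} \<and> ?Q \<subseteq> anti_rel ?N \<pi> (live H \<pi> i - {e}) (anti_lv H \<pi> i)"
    proof (cases "\<exists>x\<in>?N e. \<exists>x'\<in>?N e. x \<noteq> x' \<and> (x, x') \<in> ?Q")
      case True
      then obtain x x' where x: "x \<in> ?N e" "x' \<in> ?N e" "x \<noteq> x'" "(x, x') \<in> ?Q" by blast
      obtain z where z: "?N e = {x, x', z}" "card (?N e) = 3" "(x, z) \<notin> ?Q"
        "{a e, b e} = {x, z} \<or> {a e, b e} = {x', z}"
        using unrelated_pair_of_triple[OF eqs(1) N[OF e(1)] _ _ _ x] ends[OF e(1)] by metis
      let ?L = "free_links ?N \<pi> (live H \<pi> i - {e}) (anti_lv H \<pi> i) ?Q"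
      have symL: "sym ?L"
        using eqs(1)[of n] eqs(1)[of i] unfolding free_links_def equiv_def sym_def by blast
      have "(x, x') \<in> ?L" "(x', x) \<in> ?L"
        using x(4) eqs(1)[of n] unfolding free_links_def equiv_def by (auto dest: symD)
      moreover have "(x, z) \<in> ?L\<^sup>* \<or> (x', z) \<in> ?L\<^sup>*"
        using fl z(4) sym_rtrancl_sym[OF fl symL] by (auto simp: doubleton_eq_iff)
      ultimately have xz: "(x, z) \<in> ?L\<^sup>*" by (meson converse_rtrancl_into_rtrancl)
      have "(x, z) \<in> anti_lv H \<pi> i"
      proof -
        have "(x, z) \<in> anti_lv H \<pi> i \<or> (x', z) \<in> anti_lv H \<pi> i"
          using z(4) abi(1) eqs(1)[of i] unfolding equiv_def
          by (auto simp: doubleton_eq_iff dest: symD)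
        then show ?thesis using x(4) Qi(1) eqs(1)[of i] unfolding equiv_def by (meson subsetD transD)
      qed
      moreover have "(x, z) \<notin> conn_lv H \<pi> i"
      proof
        assume *: "(x, z) \<in> conn_lv H \<pi> i"
        then have "(x', z) \<in> conn_lv H \<pi> i" "(z, x) \<in> conn_lv H \<pi> i" "(z, x') \<in> conn_lv H \<pi> i"
          using x(4) Qi(3) eqs(2)[of i] unfolding equiv_def by (meson subsetD transD symD)+
        with * e(2) z(4) show False by (auto simp: doubleton_eq_iff)
      qed
      moreover have "(anti_lv H \<pi> i, live H \<pi> i, conn_lv H \<pi> i) \<in> hist H \<pi> (Suc n)"
        using i(1) unfolding hist_def by auto
      ultimately have "e \<in> discards H \<pi> (anti_lv H \<pi> (Suc n)) (hist H \<pi> (Suc n))"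
        using e(1) G(1) z(1-3) x(4) ends[OF e(1)] xz unfolding stable(1)
        by (intro discardsI[of _ _ x x' z _ _ "anti_lv H \<pi> i" "live H \<pi> i" "conn_lv H \<pi> i"]) auto
      then have "e \<notin> live H \<pi> (Suc n)" by (simp add: live_Suc)
      then have en: "e \<notin> live H \<pi> n" using stable(2) by simp
      \<comment> \<open>The pair \<pi>(e) would lie in a class of \<open>?Q\<close>. This class is
        connected by live hyperedges, hence without \<open>e\<close>, and \<pi>(e) would close a
        cycle.\<close>
      have "\<pi> e = {}"
      proof (rule ccontr)
        assume "\<pi> e \<noteq> {}"
        then obtain p q where pq: "\<pi> e = {p, q}" using pi[OF e(1)] by blast
        then have "(p, q) \<in> conn_lv H \<pi> n" using ends[OF e(1)] Qconn by auto
        then have "(p, q) \<in> (anti_lv H \<pi> n \<inter> pair_links \<pi> (live H \<pi> n))\<^sup>*"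
          unfolding conn_lv_def conn_rel_def by blast
        moreover have "anti_lv H \<pi> n \<inter> pair_links \<pi> (live H \<pi> n) \<subseteq> pair_links \<pi> (hedges H - {e})"
          using en live_subset_hedges[of H \<pi> n] pair_links_mono[of "live H \<pi> n" "hedges H - {e}" \<pi>]
          by blast
        ultimately have "(p, q) \<in> (pair_links \<pi> (hedges H - {e}))\<^sup>*"
          using rtrancl_mono by blast
        then show False
          using adm pq e(1) G(1) unfolding admissible_def acyc_def by blast
      qed
      moreover have "anti_rel ?N \<pi> (live H \<pi> n) (conn_lv H \<pi> n) \<subseteq>
          anti_rel ?N \<pi> (live H \<pi> i - {e}) (anti_lv H \<pi> i)"
        using en lv Qi Qconn by (intro anti_rel_mono[OF eqs(2) eqs(1)]) auto
      ultimately show ?thesis using Qanti by simp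
    next
      case False
      have "\<pi> e = {}"
      proof (rule ccontr)
        assume "\<pi> e \<noteq> {}"
        then obtain p q where "\<pi> e = {p, q}" "p \<noteq> q" "p \<in> ?N e" "q \<in> ?N e"
          using pi[OF e(1)] by blast
        then show False using False ends[OF e(1)] by auto
      qed
      moreover have "anti_rel ?N \<pi> (live H \<pi> n) (conn_lv H \<pi> n) \<subseteq>
          anti_rel ?N \<pi> (live H \<pi> i - {e}) (anti_lv H \<pi> i)" (is "_ \<subseteq> ?A")
      proof (rule anti_rel_subsetI[OF equiv_anti_rel[OF eqs(1)] eqs(2)])
        fix g p q
        assume g: "g \<in> live H \<pi> n" "\<pi> g \<times> \<pi> g \<subseteq> ?A" "p \<in> ?N g" "q \<in> ?N g" "(p, q) \<in> conn_lv H \<pi> n"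
        then have pq: "(p, q) \<in> ?Q" using Qconn by simp
        show "(p, q) \<in> ?A"
        proof (cases "g = e")
          case True
          then have "p = q" using False g pq by blast
          then show ?thesis using pq Qi(1) anti_rel.refl by (metis subsetD)
        next
          case False
          then show ?thesis using g pq Qi(1) lv(1) by (intro anti_rel_edgeI[of g]) auto
        qed
      qed
      ultimately show ?thesis using Qanti by simp
    qed
    then have "\<pi> e = {}" "(a e, b e) \<in> anti_rel ?N \<pi> (live H \<pi> i - {e}) (anti_lv H \<pi> i)"
      using fl abi by (auto intro: free_links_anti_rel[OF eqs(1)])
    then show False
      using optimal_no_exchange[OF H opt abi(2)] ends[OF e(1)] e(2) by blast
  next
    case True
    \<comment> \<open>Every \<open>g\<close> is free with \<open>a g\<close> and \<open>b g\<close>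
      in one component, so they are merged again; the failure at stage \<open>Suc i\<close> must
      therefore be a discard.\<close>
    have "(a g, b g) \<in> anti_lv H \<pi> (Suc i)" if "g \<in> G" for g
      unfolding anti_lv_Suc using that True ends[OF that] i(2) Qi(2)
      by (intro anti_rel_edgeI[of g]) (auto simp: inside_def anti_lv_Suc)
    then obtain g where g: "g \<in> G" "g \<notin> live H \<pi> (Suc i)" "(a g, b g) \<in> anti_lv H \<pi> (Suc i)"
      using i(3) unfolding inside_def by blast
    let ?P = "anti_lv H \<pi> (Suc i)"
    have gi: "g \<in> live H \<pi> i" using i(2) g(1) by (auto simp: inside_def)
    with g(2) have "g \<in> discards H \<pi> ?P (hist H \<pi> (Suc i))" by (simp add: live_Suc)
    then obtain x x' z k where w: "?N g = {x, x', z}" "(x, x') \<in> ?P" "(x, z) \<notin> ?P"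
      and k: "k \<le> i" "(x, z) \<in> anti_lv H \<pi> k" "(x, z) \<notin> conn_lv H \<pi> k"
      and fl: "(x, z) \<in> (free_links ?N \<pi> (live H \<pi> k - {g}) (anti_lv H \<pi> k) ?P)\<^sup>*"
      by (elim discards_histE)
    note pair = related_pair_of_triple[OF eqs(1) w(2,3)]
    have abx: "{a g, b g} = {x, x'}"
      using pair[OF _ _ g(3) ne[OF g(1)]] ends[OF g(1)] w(1) by auto
    \<comment> \<open>\<pi>(g) would have to be the pair {x, x'}, which is {a g, b g}; but \<pi>(g)
      lies in a class of \<open>?Q\<close>, and {a g, b g} does not.\<close>
    have "\<pi> g = {}"
    proof (rule ccontr)
      assume "\<pi> g \<noteq> {}"
      then obtain p q where pq: "\<pi> g = {p, q}" "p \<noteq> q" "p \<in> ?N g" "q \<in> ?N g"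
        using pi[OF g(1)] by blast
      moreover have sub: "\<pi> g \<times> \<pi> g \<subseteq> ?Q" using ends[OF g(1)] by blast
      ultimately have "(p, q) \<in> ?P" using Qi(2) by auto
      then have "{p, q} = {a g, b g}" using pair[of p q] pq w(1) abx by auto
      then show False using pq(1) sub ends[OF g(1)] by auto
    qed
    \<comment> \<open>The rest of the cycle merges \<open>a g\<close> and \<open>b g\<close>, so the
      only pair that \<open>g\<close> could contribute to \<open>?P\<close> is available without
      \<open>g\<close>.\<close>
    let ?B = "anti_rel ?N \<pi> (live H \<pi> i - {g}) (conn_lv H \<pi> i)"
    have eqB: "equiv (verts H) ?B" by (rule equiv_anti_rel[OF eqs(2)])
    have QB: "?Q \<subseteq> ?B"
      unfolding Qanti using g(2) lv Qi(3) Qconn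
      by (intro anti_rel_mono[OF eqs(2) eqs(2)]) auto
    have "?W g \<subseteq> ?B"
    proof (rule subrelI)
      fix p q assume "(p, q) \<in> ?W g"
      then consider "(p, q) \<in> ?Q" | h where "h \<in> G - {g}" "p = a h \<and> q = b h \<or> p = b h \<and> q = a h"
        by blast
      then show "(p, q) \<in> ?B"
      proof cases
        case 2
        then have "(a h, b h) \<in> ?B"
          using ends[of h] i(2) True QB
          by (intro anti_rel_edgeI[of h]) (auto simp: inside_def)
        then show ?thesis using 2(2) anti_rel.sym by metis
      qed (use QB in blast)
    qed
    then have "(a g, b g) \<in> ?B\<^sup>*" using cyc[OF g(1)] rtrancl_mono by blast
    then have "(a g, b g) \<in> ?B"
      using ne[OF g(1)] eqB unfolding equiv_def by (metis rtranclD trancl_id)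
    then have abB: "{a g, b g} \<times> {a g, b g} \<subseteq> ?B" by (rule equiv_pair[OF eqB])
    let ?A = "anti_rel ?N \<pi> (live H \<pi> k - {g}) (anti_lv H \<pi> k)"
    have ki: "conn_lv H \<pi> i \<subseteq> anti_lv H \<pi> k" "live H \<pi> i \<subseteq> live H \<pi> k"
      using k(1) conn_lv_subset[of H \<pi> i] anti_lv_antimono[of k i H \<pi>] live_antimono[of k i H \<pi>] by auto
    have BA: "?B \<subseteq> ?A"
      using ki by (intro anti_rel_mono[OF eqs(2) eqs(1)]) auto
    have "?P \<subseteq> ?A"
      unfolding anti_lv_Suc[of H \<pi> i]
    proof (rule anti_rel_subsetI[OF equiv_anti_rel[OF eqs(1)] eqs(2)])
      fix h p q
      assume h: "h \<in> live H \<pi> i" "\<pi> h \<times> \<pi> h \<subseteq> ?A" "p \<in> ?N h" "q \<in> ?N h" "(p, q) \<in> conn_lv H \<pi> i"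
        "(p, q) \<in> anti_rel ?N \<pi> (live H \<pi> i) (conn_lv H \<pi> i)"
      then have pq: "(p, q) \<in> ?P" "(p, q) \<in> anti_lv H \<pi> k" using ki by (auto simp: anti_lv_Suc)
      consider "h \<noteq> g" | "p = q" | "h = g" "p \<noteq> q" by blast
      then show "(p, q) \<in> ?A"
      proof cases
        case 1
        then show ?thesis using h pq ki by (intro anti_rel_edgeI[of h]) auto
      next
        case 2
        then show ?thesis using pq anti_rel.refl by metis
      next
        case 3
        then have "{p, q} = {a g, b g}" using pair[OF _ _ pq(1)] h w(1) abx by auto
        then have "p \<in> {a g, b g}" "q \<in> {a g, b g}" by blast+
        then show ?thesis using abB BA by blast
      qed
    qed
    then have "(x, z) \<in> ?A"
      using fl k(2) by (intro free_links_anti_rel[OF eqs(1)]) auto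
    moreover have "g \<in> live H \<pi> k" using gi ki by blast
    ultimately show False
      using optimal_no_exchange[OF H opt _ \<open>\<pi> g = {}\<close>, of k x z] w(1) k(3) by auto
  qed
qed

section \<open>From a stable stage to a skeletal partition\<close>

lemma connected_on_conn_rel_class:
  assumes "equiv (verts H) Q" "E \<subseteq> hedges H" "conn_rel \<pi> E Q = Q" "X \<in> verts H // Q"
  shows "connected_on H \<pi> X"
  unfolding connected_on_def graph_connected_def
proof (intro ballI)
  let ?G = "induced (star H \<pi>) X"
  let ?R = "{(x, y). y \<in> verts ?G \<and> (\<exists>e\<in>hedges ?G. ends ?G e = {x, y})}"
  fix x y assume "x \<in> verts ?G" "y \<in> verts ?G"
  then have xy: "x \<in> X" "y \<in> X" by (auto simp: induced_def)
  then have "(x, y) \<in> (Q \<inter> pair_links \<pi> E)\<^sup>*"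
    using in_quotient_imp_in_rel[OF assms(1,4)] assms(3) unfolding conn_rel_def by blast
  then have "y \<in> X \<and> (x, y) \<in> ?R\<^sup>*"
  proof (induction rule: rtrancl_induct)
    case (step y z)
    then have "z \<in> X" using in_quotient_imp_closed[OF assms(1,4)] by blast
    moreover obtain f where "f \<in> E" "\<pi> f = {y, z}" using step unfolding pair_links_def by blast
    ultimately have "(y, z) \<in> ?R"
      using step assms(2) unfolding induced_def star_def used_def by auto
    then show ?case using step \<open>z \<in> X\<close> by (meson rtrancl_into_rtrancl)
  qed (use xy in simp)
  then show "joined ?G x y"
    using rtrancl_graph_path[of x y ?G "hedges ?G"] xy unfolding joined_def
    by (auto simp: induced_def)
qed

text \<open>If every hyperedge crossing \<open>R\<close> had its \<pi>-value in no class of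
  \<open>R\<close>, then, by induction along \<open>anti_rel\<close>, merged vertices of
  \<open>X\<close> would always share a class of \<open>R\<close>, and \<open>R\<close> would have a
  single class.\<close>

lemma anticonnected_on_anti_rel_class:
  assumes Q: "equiv (verts H) Q" and E: "E \<subseteq> hedges H" and anti: "anti_rel (ends H) \<pi> E Q = Q"
    and X: "X \<in> verts H // Q"
    and size: "\<And>e. e \<in> E \<Longrightarrow> card (ends H e) \<le> 3 \<and> finite (ends H e) \<and>
      (\<pi> e = {} \<or> \<pi> e \<subseteq> ends H e \<and> card (\<pi> e) = 2)"
  shows "anticonnected_on H \<pi> X"
  unfolding anticonnected_on_def
proof (intro allI impI, rule ccontr)
  fix R assume R: "partition_on X R \<and> 2 \<le> card R"
    and none: "\<not> (\<exists>f\<in>hedges H. crossing R (ends H f) \<and> (\<exists>A\<in>R. \<pi> f \<subseteq> A))"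
  have cov: "\<Union>R = X" using R by (auto simp: partition_on_def)
  have same: "A = B" if "A \<in> R" "B \<in> R" "x \<in> A" "x \<in> B" for A B x
    using R that unfolding partition_on_def disjoint_def by blast
  have main: "\<exists>A\<in>R. x \<in> A \<and> y \<in> A" if "(x, y) \<in> anti_rel (ends H) \<pi> E Q" "x \<in> X" for x y
    using that
  proof (induction rule: anti_rel.induct)
    case (refl x)
    then show ?case using cov by blast
  next
    case (sym x y)
    have "(y, x) \<in> Q" using sym.hyps anti anti_rel.sym by metis
    then have "x \<in> X" using in_quotient_imp_closed[OF Q X] sym.prems by blast
    then show ?case using sym.IH by blast
  next
    case (trans x y z)
    then obtain A where A: "A \<in> R" "x \<in> A" "y \<in> A" by blast
    then have "y \<in> X" using cov by blast
    then obtain B where B: "B \<in> R" "y \<in> B" "z \<in> B" using trans by blast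
    have "A = B" by (rule same) (use A B in auto)
    then show ?case using A B by blast
  next
    case (edge f x y)
    have y: "y \<in> X" using in_quotient_imp_closed[OF Q X edge.prems edge.hyps(4)] .
    show ?case
    proof (rule ccontr)
      assume no: "\<not> (\<exists>A\<in>R. x \<in> A \<and> y \<in> A)"
      obtain A B where AB: "A \<in> R" "x \<in> A" "B \<in> R" "y \<in> B" using edge.prems y cov by blast
      then have "crossing R (ends H f)"
        using no edge.hyps unfolding crossing_def classes_met_def by blast
      then have nA: "\<not> \<pi> f \<subseteq> C" if "C \<in> R" for C using none that edge.hyps(1) E by blast
      then have "\<pi> f \<noteq> {}" using AB by blast
      then have f: "\<pi> f \<subseteq> ends H f" "card (\<pi> f) = 2" using size[OF edge.hyps(1)] by blast+
      \<comment> \<open>This is where size at most 3 matters: x, y and two vertices of \<pi>(f)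
        outside \<open>X\<close> would be four. The induction hypothesis needs a starting vertex in
        \<open>X\<close>.\<close>
      have "\<pi> f \<inter> X \<noteq> {}"
      proof
        assume "\<pi> f \<inter> X = {}"
        then have "{x, y} \<inter> \<pi> f = {}" using edge.prems y by blast
        moreover have "x \<noteq> y" using no AB by blast
        ultimately have "card ({x, y} \<union> \<pi> f) = 4"
          using f by (subst card_Un_disjoint) (auto intro: card_ge_0_finite)
        moreover have "card ({x, y} \<union> \<pi> f) \<le> card (ends H f)"
          using f edge.hyps(2,3) size[OF edge.hyps(1)] by (intro card_mono) auto
        ultimately show False using size[OF edge.hyps(1)] by simp
      qed
      then obtain p where p: "p \<in> \<pi> f" "p \<in> X" by blast
      then obtain C where C: "C \<in> R" "p \<in> C" using cov by blast
      have "\<pi> f \<subseteq> C"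
      proof
        fix q assume "q \<in> \<pi> f"
        then obtain D where D: "D \<in> R" "p \<in> D" "q \<in> D" using edge.IH p by blast
        have "C = D" by (rule same) (use C D in auto)
        then show "q \<in> C" using D by simp
      qed
      then show False using nA C by blast
    qed
  qed
  have one: "\<exists>A\<in>R. x \<in> A \<and> y \<in> A" if "x \<in> X" "y \<in> X" for x y
  proof (rule main)
    show "(x, y) \<in> anti_rel (ends H) \<pi> E Q"
      unfolding anti using that by (intro in_quotient_imp_in_rel[OF Q X]) simp
  qed (rule that(1))
  have "R \<noteq> {}" "\<not> is_singleton R" using R by (auto simp: is_singleton_altdef)
  then obtain A B where AB: "A \<in> R" "B \<in> R" "A \<noteq> B" by (meson is_singletonI' ex_in_conv)
  moreover have "A \<noteq> {}" "B \<noteq> {}" using AB R by (auto simp: partition_on_def)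
  ultimately obtain x y where xy: "x \<in> A" "y \<in> B" by blast
  then obtain C where C: "C \<in> R" "x \<in> C" "y \<in> C" using one[of x y] AB cov by blast
  have "A = C" "B = C"
    using same[of A C x] same[of B C y] AB xy C by auto
  then show False using AB by simp
qed

lemma optimal_skeletal:
  assumes H: "three_hypergraph H" and opt: "optimal H \<pi>"
  shows "\<exists>S. skeletal H \<pi> S"
proof -
  obtain n where stable: "anti_lv H \<pi> (Suc n) = anti_lv H \<pi> n" "live H \<pi> (Suc n) = live H \<pi> n"
    by (rule levels_stabilize[OF H])
  have adm: "admissible H \<pi>" using opt by (simp add: optimal_def)
  let ?N = "ends H"
  define Q where "Q = anti_lv H \<pi> n"
  define P where "P = verts H // Q"
  have eqQ: "equiv (verts H) Q" unfolding Q_def by (rule equiv_levels)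
  have conn: "conn_lv H \<pi> n = Q"
    using anti_lv_Suc_subset[of H \<pi> n] conn_lv_subset[of H \<pi> n] stable(1) by (auto simp: Q_def)
  have part: "partition_on (verts H) P" unfolding P_def by (rule partition_on_quotient[OF eqQ])
  have "connected_on H \<pi> X" if "X \<in> P" for X
    using connected_on_conn_rel_class[OF eqQ live_subset_hedges[of H \<pi> n]] that conn
    unfolding P_def conn_lv_def Q_def by simp
  moreover have "anticonnected_on H \<pi> X" if "X \<in> P" for X
  proof (rule anticonnected_on_anti_rel_class[OF eqQ live_subset_hedges[of H \<pi> n]])
    show "anti_rel ?N \<pi> (live H \<pi> n) Q = Q"
      using stable(1) conn by (simp add: anti_lv_Suc Q_def)
    fix e assume "e \<in> live H \<pi> n"
    then have "e \<in> hedges H" using live_subset_hedges[of H \<pi> n] by blast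
    moreover from this have "finite (?N e)"
      using H unfolding three_hypergraph_def by (meson finite_subset)
    ultimately show "card (?N e) \<le> 3 \<and> finite (?N e) \<and> (\<pi> e = {} \<or> \<pi> e \<subseteq> ?N e \<and> card (\<pi> e) = 2)"
      using H adm unfolding three_hypergraph_def admissible_def quasigraph_def by auto
  qed (use that P_def in simp)
  moreover have "acyclic_hypergraph (unused_part (contract H P) (contract_quasi \<pi> P))"
    unfolding acyclic_hypergraph_def
  proof
    let ?U = "unused_part (contract H P) (contract_quasi \<pi> P)"
    assume "\<exists>\<gamma>. quasicycle ?U \<gamma>"
    then obtain \<gamma> vs es where qc: "quasigraph ?U \<gamma>" "graph_cycle (star ?U \<gamma>) vs es"
      unfolding quasicycle_def by blast
    let ?n = "length es"
    have c: "length vs = ?n" "2 \<le> ?n" "distinct vs" "distinct es" "set vs \<subseteq> P"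
      "set es \<subseteq> used ?U \<gamma>" "\<And>i. i < ?n \<Longrightarrow> \<gamma> (es ! i) = {vs ! i, vs ! (Suc i mod ?n)}"
      using qc(2) unfolding graph_cycle_def star_def unused_part_def contract_def by auto
    have es: "e \<in> hedges H" "\<not> crossing P (\<pi> e)" "\<gamma> e \<subseteq> classes_met P (?N e)" if "e \<in> set es" for e
    proof -
      have e: "e \<in> hedges ?U" "\<gamma> e \<noteq> {}" using c(6) that by (auto simp: used_def)
      then show "e \<in> hedges H" by (auto simp: unused_part_def contract_def)
      show "\<gamma> e \<subseteq> classes_met P (?N e)"
        using e qc(1) unfolding quasigraph_def by (fastforce simp: unused_part_def contract_def)
      show "\<not> crossing P (\<pi> e)"
      proof
        assume cr: "crossing P (\<pi> e)"
        then have "contract_quasi \<pi> P e \<noteq> {}"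
          unfolding contract_quasi_def crossing_def by auto
        then show False using e(1) by (auto simp: unused_part_def used_def)
      qed
    qed
    have piV: "\<pi> e \<subseteq> verts H" if "e \<in> set es" for e
      using H adm es(1)[OF that] unfolding three_hypergraph_def admissible_def quasigraph_def by blast
    have piQ: "\<pi> e \<times> \<pi> e \<subseteq> Q" if "e \<in> set es" for e
    proof (rule subrelI)
      fix p q assume "(p, q) \<in> \<pi> e \<times> \<pi> e"
      then have pq: "p \<in> \<pi> e" "q \<in> \<pi> e" "p \<in> verts H" "q \<in> verts H" using piV[OF that] by auto
      then have "Q `` {p} \<in> classes_met P (\<pi> e)" "Q `` {q} \<in> classes_met P (\<pi> e)"
        using equiv_class_self[OF eqQ] unfolding classes_met_def P_def by (auto intro: quotientI)
      then have "Q `` {p} = Q `` {q}" using es(2)[OF that] unfolding crossing_def by blast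
      then show "(p, q) \<in> Q" using eq_equiv_class[OF _ eqQ] pq by metis
    qed
    \<comment> \<open>The quasicycle is lifted to vertices: \<open>fst p\<close> and
      \<open>snd p\<close> are vertices of \<open>e\<close> in the two classes that \<open>e\<close>
      joins, in cyclic order.\<close>
    have "\<exists>p. fst p \<in> ?N e \<and> snd p \<in> ?N e \<and> (\<exists>k<?n. es ! k = e \<and> fst p \<in> vs ! k \<and>
        snd p \<in> vs ! (Suc k mod ?n))" if e: "e \<in> set es" for e
    proof -
      obtain k where k: "k < ?n" "es ! k = e" using e by (auto simp: in_set_conv_nth)
      then have "vs ! k \<in> classes_met P (?N e)" "vs ! (Suc k mod ?n) \<in> classes_met P (?N e)"
        using c(7)[OF k(1)] es(3)[OF e] by auto
      then obtain u v where "u \<in> vs ! k" "u \<in> ?N e" "v \<in> vs ! (Suc k mod ?n)" "v \<in> ?N e"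
        unfolding classes_met_def by blast
      then show ?thesis using k by (intro exI[of _ "(u, v)"]) auto
    qed
    then obtain h where h: "\<And>e. e \<in> set es \<Longrightarrow> fst (h e) \<in> ?N e \<and> snd (h e) \<in> ?N e \<and>
        (\<exists>k<?n. es ! k = e \<and> fst (h e) \<in> vs ! k \<and> snd (h e) \<in> vs ! (Suc k mod ?n))"
      by metis
    have hk: "fst (h (es ! k)) \<in> vs ! k" "snd (h (es ! k)) \<in> vs ! (Suc k mod ?n)" if k: "k < ?n" for k
    proof -
      obtain j where "j < ?n" "es ! j = es ! k" "fst (h (es ! k)) \<in> vs ! j"
        "snd (h (es ! k)) \<in> vs ! (Suc j mod ?n)" using h[of "es ! k"] k by auto
      then show "fst (h (es ! k)) \<in> vs ! k" "snd (h (es ! k)) \<in> vs ! (Suc k mod ?n)"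
        using c(4) k by (auto simp: nth_eq_iff_index_eq)
    qed
    have inP: "vs ! k \<in> P" if "k < ?n" for k using c(1,5) that by auto
    show False
    proof (rule optimal_no_free_cycle[OF H opt stable, where G = "set es" and a = "fst \<circ> h" and b = "snd \<circ> h"])
      show "set es \<subseteq> hedges H" using es by blast
      show "set es \<noteq> {}" using c(2) by auto
      fix e assume e: "e \<in> set es"
      then obtain k where k: "k < ?n" "es ! k = e" by (auto simp: in_set_conv_nth)
      have sk: "Suc k mod ?n < ?n" using k by (intro mod_less_divisor) linarith
      have "Suc k mod ?n \<noteq> k" using k(1) c(2) by (cases "Suc k < ?n") (auto simp: mod_if)
      then have "vs ! k \<noteq> vs ! (Suc k mod ?n)"
        using c(1,3) k(1) sk by (simp add: nth_eq_iff_index_eq)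
      then have "(fst (h e), snd (h e)) \<notin> Q"
        using hk[OF k(1)] k(2) quotient_eq_iff[OF eqQ] inP k(1) sk unfolding P_def by blast
      then show "\<pi> e \<times> \<pi> e \<subseteq> anti_lv H \<pi> n \<and> (fst \<circ> h) e \<in> ?N e \<and> (snd \<circ> h) e \<in> ?N e \<and>
          ((fst \<circ> h) e, (snd \<circ> h) e) \<notin> anti_lv H \<pi> n"
        using piQ[OF e] h[OF e] by (simp add: Q_def)
      let ?W = "Q \<union> {(x, y). \<exists>g\<in>set es - {e}. x = (fst \<circ> h) g \<and> y = (snd \<circ> h) g \<or>
          x = (snd \<circ> h) g \<and> y = (fst \<circ> h) g}"
      \<comment> \<open>The cycle is traversed on classes: A is related to B if every vertex of A
        reaches every vertex of B. Membership in \<open>P\<close> is carried along because composing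
        two steps needs a vertex in the middle class.\<close>
      let ?R = "{(A, B). B \<in> P \<and> (\<forall>x\<in>A. \<forall>y\<in>B. (x, y) \<in> ?W\<^sup>*)}"
      have "(vs ! (Suc k mod ?n), vs ! k) \<in> ?R\<^sup>*"
      proof (rule around_cycle[OF k(1)])
        fix i assume i: "i < ?n" "i \<noteq> k"
        have si: "Suc i mod ?n < ?n" using k by (intro mod_less_divisor) linarith
        let ?u = "fst (h (es ! i))" and ?v = "snd (h (es ! i))"
        have "es ! i \<in> set es - {e}"
          using i k c(4) by (auto simp: nth_eq_iff_index_eq)
        then have uv: "(?u, ?v) \<in> ?W"
          by (intro UnI2) (auto intro!: bexI[of _ "es ! i"])
        have "(x, y) \<in> ?W\<^sup>*" if "x \<in> vs ! i" "y \<in> vs ! (Suc i mod ?n)" for x y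
        proof -
          have "(x, ?u) \<in> ?W" "(?v, y) \<in> ?W"
            using that hk[OF i(1)] in_quotient_imp_in_rel[OF eqQ] inP[OF i(1)] inP[OF si]
            unfolding P_def by blast+
          with uv show ?thesis by (meson r_into_rtrancl rtrancl_trans)
        qed
        then show "(vs ! i, vs ! (Suc i mod ?n)) \<in> ?R" using inP[OF si] by blast
      qed
      moreover have "B \<in> P \<and> (\<forall>x\<in>A. \<forall>y\<in>B. (x, y) \<in> ?W\<^sup>*)" if "(A, B) \<in> ?R\<^sup>*" "A \<in> P" for A B
        using that(1)
      proof (induction rule: rtrancl_induct)
        case base
        have "(x, y) \<in> ?W" if "x \<in> A" "y \<in> A" for x y
          using that in_quotient_imp_in_rel[OF eqQ] \<open>A \<in> P\<close> unfolding P_def by blast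
        then show ?case using that(2) by blast
      next
        case (step B C)
        have "B \<noteq> {}" using step.IH part by (auto simp: partition_on_def)
        then obtain y where "y \<in> B" by blast
        with step show ?case by (blast intro: rtrancl_trans)
      qed
      ultimately have "(snd (h e), fst (h e)) \<in> ?W\<^sup>*"
        using hk[OF k(1)] k(2) inP[OF sk] by blast
      moreover have "sym ?W"
        using eqQ unfolding equiv_def sym_def by blast
      ultimately have "(fst (h e), snd (h e)) \<in> ?W\<^sup>*" by (rule sym_rtrancl_sym)
      then show "((fst \<circ> h) e, (snd \<circ> h) e) \<in> (anti_lv H \<pi> n \<union> {(x, y). \<exists>g\<in>set es - {e}.
          x = (fst \<circ> h) g \<and> y = (snd \<circ> h) g \<or> x = (snd \<circ> h) g \<and> y = (fst \<circ> h) g})\<^sup>*"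
        by (simp add: Q_def)
    qed
  qed
  ultimately show ?thesis using part unfolding skeletal_def by blast
qed

section \<open>Bad leaves\<close>

locale bad_leaf_switch =
  fixes H H' :: "('v, 'e) hypergraph" and \<pi> :: "'e \<Rightarrow> 'v set"
    and u a b c d :: 'v and e1 e2 e3 :: 'e
  assumes H: "three_hypergraph H"
    and opt: "optimal H \<pi>"
    and edges: "e1 \<in> hedges H" "e2 \<in> hedges H" "e3 \<in> hedges H" "distinct [e1, e2, e3]"
    and ends: "ends H e1 = {u, a}" "ends H e2 = {u, b}" "ends H e3 = {u, c, d}"
    and card: "card (ends H e1) = 2" "card (ends H e2) = 2" "card (ends H e3) = 3"
    and pi: "\<pi> e1 = {}" "\<pi> e2 = {}" "\<pi> e3 = {u, c}"
    and leaf: "\<And>f. f \<in> hedges H \<Longrightarrow> u \<in> \<pi> f \<Longrightarrow> f = e3"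
    and H': "H' = H\<lparr>ends := (ends H)(e1 := {u, a, b}, e2 := {u, d}, e3 := {u, c})\<rparr>"
begin

lemma sizes: "u \<noteq> a" "u \<noteq> b" "u \<noteq> c" "u \<noteq> d" "c \<noteq> d"
  using card unfolding ends by (auto simp: card_insert_if split: if_splits)

lemma same [simp]: "verts H' = verts H" "hedges H' = hedges H"
  by (simp_all add: H')

lemma ends': "ends H' e1 = {u, a, b}" "ends H' e2 = {u, d}" "ends H' e3 = {u, c}"
  "f \<notin> {e1, e2, e3} \<Longrightarrow> ends H' f = ends H f"
  using edges by (auto simp: H')

lemma three_hypergraph_switch: "three_hypergraph H'"
proof -
  have "{u, a} \<subseteq> verts H" "{u, b} \<subseteq> verts H" "{u, c, d} \<subseteq> verts H"
    using H edges unfolding three_hypergraph_def ends[symmetric] by blast+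
  moreover have "card {u, a, b} \<in> {2, 3}"
    using sizes by (auto simp: card_insert_if)
  ultimately have "ends H' e \<subseteq> verts H' \<and> card (ends H' e) \<in> {2, 3}" if "e \<in> hedges H'" for e
    using H that sizes unfolding three_hypergraph_def H' by auto
  then show ?thesis using H by (auto simp: three_hypergraph_def)
qed

lemma admissible_switch: "admissible H' \<pi>"
proof -
  have "quasigraph H' \<pi>"
    using opt pi unfolding optimal_def admissible_def quasigraph_def H'
    by (auto simp: card_insert_if sizes)
  then show ?thesis using opt unfolding optimal_def admissible_def acyc_def by simp
qed

lemma pairs_live: "e1 \<in> live H \<pi> n" "e2 \<in> live H \<pi> n"
  using edges card by (auto intro: pair_in_live)

lemma anti_lv_sym: "(x, y) \<in> anti_lv H \<pi> n \<Longrightarrow> (y, x) \<in> anti_lv H \<pi> n"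
  using equiv_levels(1)[of H \<pi> n] unfolding equiv_def by (auto dest: symD)

lemma anti_lv_trans: "(x, y) \<in> anti_lv H \<pi> n \<Longrightarrow> (y, z) \<in> anti_lv H \<pi> n \<Longrightarrow> (x, z) \<in> anti_lv H \<pi> n"
  using equiv_levels(1)[of H \<pi> n] unfolding equiv_def by (auto dest: transD)

text \<open>Otherwise \<open>e1\<close> could be exchanged at the stage where \<open>u\<close> is separated from \<open>a\<close> and \<open>b\<close>.\<close>
lemma leaf_with_neighbours:
  assumes "(a, b) \<in> anti_lv H \<pi> j"
  shows "(u, a) \<in> anti_lv H \<pi> j"
proof (rule ccontr)
  assume no: "(u, a) \<notin> anti_lv H \<pi> j"
  have "(u, a) \<in> anti_lv H \<pi> 0"
    using H edges(1) ends(1) unfolding three_hypergraph_def by fastforce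
  with no obtain l where l: "l < j" "(u, a) \<in> anti_lv H \<pi> l" "(u, a) \<notin> anti_lv H \<pi> (Suc l)"
    using ex_least_nat_less[of "\<lambda>i. (u, a) \<notin> anti_lv H \<pi> i" j] by auto
  have "(u, a) \<notin> conn_lv H \<pi> l"
  proof
    assume "(u, a) \<in> conn_lv H \<pi> l"
    then have "(u, a) \<in> anti_lv H \<pi> (Suc l)"
      unfolding anti_lv_Suc using pairs_live ends pi by (intro anti_rel_edgeI[of e1]) auto
    then show False using l by blast
  qed
  moreover have "(u, a) \<in> conn_lv H \<pi> l"
  proof (rule optimal_no_exchange[OF H opt pairs_live(1) pi(1)])
    let ?A = "anti_rel (ends H) \<pi> (live H \<pi> l - {e1}) (anti_lv H \<pi> l)"
    \<comment> \<open>\<open>e1\<close> merges nothing at level \<open>Suc l\<close>, where its ends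
      are apart. So this level, and with it the pair (a, b), is generated without \<open>e1\<close>,
      and from \<open>b\<close> the free hyperedge \<open>e2\<close> leads on to
      \<open>u\<close>.\<close>
    have "anti_lv H \<pi> (Suc l) \<subseteq> ?A"
      unfolding anti_lv_Suc
    proof (rule anti_rel_subsetI[OF equiv_anti_rel[OF equiv_levels(1)] equiv_levels(2)])
      fix f x y
      assume f: "f \<in> live H \<pi> l" "\<pi> f \<times> \<pi> f \<subseteq> ?A" "x \<in> ends H f" "y \<in> ends H f"
        "(x, y) \<in> conn_lv H \<pi> l"
        "(x, y) \<in> anti_rel (ends H) \<pi> (live H \<pi> l) (conn_lv H \<pi> l)"
      have xy: "(x, y) \<in> anti_lv H \<pi> l" using f(5) conn_lv_subset[of H \<pi> l] by blast
      show "(x, y) \<in> ?A"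
      proof (cases "f = e1")
        case True
        moreover have "(a, u) \<notin> anti_lv H \<pi> (Suc l)" using l(3) anti_lv_sym by blast
        ultimately have "x = y" using f(3,4,6) l(3) ends(1) by (auto simp: anti_lv_Suc)
        then show ?thesis using xy anti_rel.refl by metis
      next
        case False
        then show ?thesis using f xy by (intro anti_rel_edgeI[of f]) auto
      qed
    qed
    moreover have ab: "(a, b) \<in> anti_lv H \<pi> (Suc l)"
      using assms l(1) anti_lv_antimono[of "Suc l" j H \<pi>] by auto
    ultimately have "(a, b) \<in> ?A" by blast
    moreover have "(u, b) \<in> anti_lv H \<pi> l"
      using l(2) ab anti_lv_antimono[of l "Suc l" H \<pi>] anti_lv_trans by auto
    then have "(u, b) \<in> ?A"
      using pairs_live ends pi edges(4) by (intro anti_rel_edgeI[of e2]) auto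
    ultimately show "(u, a) \<in> ?A" using anti_rel.sym anti_rel.trans by metis
  qed (use ends in auto)
  ultimately show False by contradiction
qed

text \<open>Links of \<open>H'\<close> are imitated in \<open>H\<close>: {u, a, b} by
  \<open>e1\<close> and \<open>e2\<close>, where for a link between \<open>a\<close> and
  \<open>b\<close> the class also contains \<open>u\<close> by \<open>leaf_with_neighbours\<close>;
  {u, d} by the old \<open>e3\<close>, which is free because \<open>u\<close> and \<open>c\<close>
  share a class of level \<open>j\<close>; {u, c} is a pair of that level anyway. \<open>F'\<close>
  and \<open>F\<close> are separate so that \<open>e1\<close> can be left out in \<open>H'\<close>
  while \<open>e1\<close> or \<open>e2\<close> is left out in \<open>H\<close>.\<close>

lemma free_links_switch_subset:
  assumes "F' - {e1, e2, e3} \<subseteq> F" "e3 \<in> F" "e1 \<in> F' \<Longrightarrow> e1 \<in> F \<and> e2 \<in> F"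
    and "(u, c) \<in> anti_lv H \<pi> j" "i \<le> j"
  shows "(free_links (ends H') \<pi> F' (anti_lv H \<pi> i) (anti_lv H \<pi> j))\<^sup>* \<subseteq>
    (free_links (ends H) \<pi> F (anti_lv H \<pi> i) (anti_lv H \<pi> j))\<^sup>*"
proof (rule rtrancl_subset_rtrancl, rule subrelI)
  let ?Q = "anti_lv H \<pi> i" and ?P = "anti_lv H \<pi> j"
  let ?L = "free_links (ends H) \<pi> F ?Q ?P"
  have uc: "{u, c} \<times> {u, c} \<subseteq> ?P" by (rule equiv_pair[OF equiv_levels(1) assms(4)])
  have link: "(x, y) \<in> ?L" if "(x, y) \<in> ?Q" "f \<in> F" "x \<in> ends H f" "y \<in> ends H f" "\<pi> f \<times> \<pi> f \<subseteq> ?P"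
    for x y f using that unfolding free_links_def by blast
  fix x y assume "(x, y) \<in> free_links (ends H') \<pi> F' ?Q ?P"
  then consider "(x, y) \<in> ?P" | "x = y"
    | f where "(x, y) \<in> ?Q" "f \<in> F'" "x \<in> ends H' f" "y \<in> ends H' f" "\<pi> f \<times> \<pi> f \<subseteq> ?P" "x \<noteq> y"
    unfolding free_links_def by blast
  then show "(x, y) \<in> ?L\<^sup>*"
  proof cases
    case 1
    then show ?thesis unfolding free_links_def by blast
  next
    case f: 3
    consider "f \<notin> {e1, e2, e3}" | "f = e1" | "f = e2" | "f = e3" by blast
    then show ?thesis
    proof cases
      case 1
      then show ?thesis using f ends'(4)[OF 1] assms(1) link[of x y f] by auto
    next
      case 2
      then have F: "e1 \<in> F" "e2 \<in> F" using f(2) assms(3) by auto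
      have l1: "(u, a) \<in> ?L" "(a, u) \<in> ?L" if "(u, a) \<in> ?Q"
        using that anti_lv_sym[OF that] F ends pi by (auto intro!: link[of _ _ e1])
      have l2: "(u, b) \<in> ?L" "(b, u) \<in> ?L" if "(u, b) \<in> ?Q"
        using that anti_lv_sym[OF that] F ends pi by (auto intro!: link[of _ _ e2])
      have "x \<in> {u, a, b}" "y \<in> {u, a, b}" using f 2 ends' by auto
      then consider "x = u \<and> y = a \<or> x = a \<and> y = u" | "x = u \<and> y = b \<or> x = b \<and> y = u"
        | "x = a \<and> y = b \<or> x = b \<and> y = a" using f(6) by auto
      then show ?thesis
      proof cases
        case 1
        then have "(u, a) \<in> ?Q" using f(1) anti_lv_sym by blast
        then show ?thesis using l1 1 by blast
      next
        case 2
        then have "(u, b) \<in> ?Q" using f(1) anti_lv_sym by blast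
        then show ?thesis using l2 2 by blast
      next
        case 3
        then have ab: "(a, b) \<in> ?Q" using f(1) anti_lv_sym by blast
        have ua: "(u, a) \<in> ?Q" by (rule leaf_with_neighbours[OF ab])
        have ub: "(u, b) \<in> ?Q" by (rule anti_lv_trans[OF ua ab])
        show ?thesis using l1[OF ua] l2[OF ub] 3 by (meson r_into_rtrancl rtrancl_into_rtrancl)
      qed
    next
      case 3
      then show ?thesis using f ends' ends pi assms(2) uc by (intro r_into_rtrancl link[of _ _ e3]) auto
    next
      case 4
      then have "(x, y) \<in> ?P" using f ends' uc by auto
      then show ?thesis unfolding free_links_def by blast
    qed
  qed simp
qed

text \<open>{u, a, b} contains both old pairs, and a link through {u, c, d} is imitated by {u, d}
  and a step between \<open>u\<close> and \<open>c\<close> inside level \<open>j\<close>.\<close>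

lemma free_links_switch_supset:
  assumes "e1 \<in> F" "e2 \<in> F" "(u, c) \<in> anti_lv H \<pi> j" "i \<le> j"
  shows "(free_links (ends H) \<pi> F (anti_lv H \<pi> i) (anti_lv H \<pi> j))\<^sup>* \<subseteq>
    (free_links (ends H') \<pi> F (anti_lv H \<pi> i) (anti_lv H \<pi> j))\<^sup>*"
proof (rule rtrancl_subset_rtrancl, rule subrelI)
  let ?Q = "anti_lv H \<pi> i" and ?P = "anti_lv H \<pi> j"
  let ?L = "free_links (ends H') \<pi> F ?Q ?P"
  have PQ: "?P \<subseteq> ?Q" using assms(4) by (rule anti_lv_antimono)
  have link: "(x, y) \<in> ?L\<^sup>*" if "(x, y) \<in> ?Q" "f \<in> F" "x \<in> ends H' f" "y \<in> ends H' f" "\<pi> f \<times> \<pi> f \<subseteq> ?P"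
    for x y f using that unfolding free_links_def by blast
  have P: "(x, y) \<in> ?L\<^sup>*" if "(x, y) \<in> ?P" for x y using that unfolding free_links_def by blast
  fix x y assume "(x, y) \<in> free_links (ends H) \<pi> F ?Q ?P"
  then consider "(x, y) \<in> ?P" | "x = y"
    | f where "(x, y) \<in> ?Q" "f \<in> F" "x \<in> ends H f" "y \<in> ends H f" "\<pi> f \<times> \<pi> f \<subseteq> ?P" "x \<noteq> y"
    unfolding free_links_def by blast
  then show "(x, y) \<in> ?L\<^sup>*"
  proof cases
    case f: 3
    consider "f \<notin> {e1, e2, e3}" | "f = e1 \<or> f = e2" | "f = e3" by blast
    then show ?thesis
    proof cases
      case 1
      then show ?thesis using f ends'(4)[OF 1] link[of x y f] by auto
    next
      case 2
      then have "x \<in> ends H' e1" "y \<in> ends H' e1" using f ends ends' by auto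
      then show ?thesis using f(1) assms(1) pi link[of x y e1] by auto
    next
      case 3
      have cu: "(c, u) \<in> ?P" by (rule anti_lv_sym[OF assms(3)])
      have l2: "(u, d) \<in> ?L\<^sup>*" "(d, u) \<in> ?L\<^sup>*" if "(u, d) \<in> ?Q"
        using that anti_lv_sym[OF that] assms(2) ends' pi by (auto intro!: link[of _ _ e2])
      have "x \<in> {u, c, d}" "y \<in> {u, c, d}" using f 3 ends by auto
      then consider "x = u \<and> y = c \<or> x = c \<and> y = u" | "x = u \<and> y = d \<or> x = d \<and> y = u"
        | "x = c \<and> y = d \<or> x = d \<and> y = c" using f(6) by auto
      then show ?thesis
      proof cases
        case 1
        then show ?thesis using P assms(3) cu by blast
      next
        case 2
        then have "(u, d) \<in> ?Q" using f(1) anti_lv_sym by blast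
        then show ?thesis using l2 2 by blast
      next
        case 3
        then have "(c, d) \<in> ?Q" using f(1) anti_lv_sym by blast
        then have "(u, d) \<in> ?Q" using assms(3) PQ anti_lv_trans by blast
        then show ?thesis using l2 3 P[OF assms(3)] P[OF cu] by (meson rtrancl_trans)
      qed
    qed
  qed (use P in simp_all)
qed

text \<open>As u and t are apart at level \<open>Suc k\<close>, \<open>e\<close> merges nothing
  there and the level is generated without \<open>e\<close>. The free walk then makes
  \<open>e\<close> exchangeable at stage \<open>i\<close>, which optimality excludes unless its ends
  already share a component.\<close>

lemma no_exchange_pair:
  assumes e: "e = e1 \<or> e = e2" "ends H e = {u, t}" and "(u, t) \<in> anti_lv H \<pi> i"
    "(u, t) \<notin> anti_lv H \<pi> (Suc k)" "i \<le> k"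
    "(u, t) \<in> (free_links (ends H) \<pi> (live H \<pi> i - {e}) (anti_lv H \<pi> i) (anti_lv H \<pi> (Suc k)))\<^sup>*"
  shows "(u, t) \<in> conn_lv H \<pi> i"
proof (rule optimal_no_exchange[OF H opt])
  let ?A = "anti_rel (ends H) \<pi> (live H \<pi> i - {e}) (anti_lv H \<pi> i)"
  have "anti_lv H \<pi> (Suc k) \<subseteq> ?A"
    unfolding anti_lv_Suc
  proof (rule anti_rel_subsetI[OF equiv_anti_rel[OF equiv_levels(1)] equiv_levels(2)])
    fix f x y
    assume f: "f \<in> live H \<pi> k" "\<pi> f \<times> \<pi> f \<subseteq> ?A" "x \<in> ends H f" "y \<in> ends H f"
      "(x, y) \<in> conn_lv H \<pi> k"
      "(x, y) \<in> anti_rel (ends H) \<pi> (live H \<pi> k) (conn_lv H \<pi> k)"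
    have xy: "(x, y) \<in> anti_lv H \<pi> i"
      using f(5) conn_lv_subset[of H \<pi> k] anti_lv_antimono[OF assms(5), of H \<pi>] by blast
    show "(x, y) \<in> ?A"
    proof (cases "f = e")
      case True
      moreover have "(t, u) \<notin> anti_lv H \<pi> (Suc k)" using assms(4) anti_lv_sym by blast
      ultimately have "x = y" using f(3,4,6) assms(4) e(2) by (auto simp: anti_lv_Suc)
      then show ?thesis using xy anti_rel.refl by metis
    next
      case False
      then show ?thesis
        using f xy live_antimono[OF assms(5), of H \<pi>] by (intro anti_rel_edgeI[of f]) auto
    qed
  qed
  then show "(u, t) \<in> ?A"
    using assms(3,6) by (intro free_links_anti_rel[OF equiv_levels(1)]) auto
qed (use e pairs_live pi in auto)

text \<open>Hyperedges away from \<open>u\<close> see the same free walks in both hypergraphs, and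
  \<open>e3\<close> has size 2 in \<open>H'\<close>. The evidence for discarding the new
  \<open>e1\<close> would make \<open>e1\<close> or \<open>e2\<close> exchangeable in
  \<open>H\<close>.\<close>

lemma discards_switch:
  assumes uc: "(u, c) \<in> anti_lv H \<pi> (Suc k)" and e3: "e3 \<in> live H \<pi> k"
  shows "discards H' \<pi> (anti_lv H \<pi> (Suc k)) (hist H \<pi> (Suc k)) =
    discards H \<pi> (anti_lv H \<pi> (Suc k)) (hist H \<pi> (Suc k)) - {e3}"
proof -
  let ?P = "anti_lv H \<pi> (Suc k)"
  have e3i: "e3 \<in> live H \<pi> i" if "i \<le> k" for i using e3 live_antimono[OF that, of H \<pi>] by blast
  have Pconn: "?P \<subseteq> conn_lv H \<pi> i" if "i \<le> k" for i
    using that by (intro anti_lv_subset_conn_lv) simp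
  have old: "g \<in> discards H' \<pi> ?P (hist H \<pi> (Suc k)) \<longleftrightarrow> g \<in> discards H \<pi> ?P (hist H \<pi> (Suc k))"
    if g: "g \<notin> {e1, e2, e3}" for g
  proof -
    have "(free_links (ends H') \<pi> (live H \<pi> i - {g}) (anti_lv H \<pi> i) ?P)\<^sup>* =
        (free_links (ends H) \<pi> (live H \<pi> i - {g}) (anti_lv H \<pi> i) ?P)\<^sup>*" if "i < Suc k" for i
      using that g e3i[of i] pairs_live[of i]
      by (intro equalityI free_links_switch_subset[OF _ _ _ uc] free_links_switch_supset[OF _ _ uc])
        auto
    then have "(\<exists>(Q, E, C)\<in>hist H \<pi> (Suc k). (x, z) \<in> Q \<and> (x, z) \<notin> C \<and>
          (x, z) \<in> (free_links (ends H') \<pi> (E - {g}) Q ?P)\<^sup>*) \<longleftrightarrow>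
        (\<exists>(Q, E, C)\<in>hist H \<pi> (Suc k). (x, z) \<in> Q \<and> (x, z) \<notin> C \<and>
          (x, z) \<in> (free_links (ends H) \<pi> (E - {g}) Q ?P)\<^sup>*)" for x z
      by (intro bex_cong refl) (auto simp: hist_def)
    then show ?thesis
      unfolding discards_def by (simp add: ends'(4)[OF g])
  qed
  have two: "card (ends H' e2) = 2" "card (ends H' e3) = 2"
    using sizes by (simp_all add: ends')
  have "e1 \<notin> discards H' \<pi> ?P (hist H \<pi> (Suc k))"
  proof
    assume "e1 \<in> discards H' \<pi> ?P (hist H \<pi> (Suc k))"
    then obtain x x' z i where w: "{u, a, b} = {x, x', z}" "card {u, a, b} = 3"
        "(x, x') \<in> ?P" "(x, z) \<notin> ?P"
      and i: "i \<le> k" "(x, z) \<in> anti_lv H \<pi> i" "(x, z) \<notin> conn_lv H \<pi> i"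
        "(x, z) \<in> (free_links (ends H') \<pi> (live H \<pi> i - {e1}) (anti_lv H \<pi> i) ?P)\<^sup>*"
      unfolding ends'(1)[symmetric] by (rule discards_histE)
    \<comment> \<open>When \<open>u\<close> is one of x, x', the third vertex \<open>z\<close> is
      \<open>a\<close> or \<open>b\<close>, and {u, z} is an old hyperedge to which
      \<open>no_exchange_pair\<close> applies.\<close>
    have key: False if s: "{x, x'} = {u, s}" and e: "e = e1 \<or> e = e2" "ends H e = {u, z}" for s e
    proof -
      let ?L = "free_links (ends H) \<pi> (live H \<pi> i - {e}) (anti_lv H \<pi> i) ?P"
      have ux: "(u, x) \<in> ?P"
      proof -
        have "(x, x) \<in> ?P" using w(3) anti_lv_sym anti_lv_trans by blast
        moreover have "u = x \<or> u = x'" using s by (auto simp: doubleton_eq_iff)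
        ultimately show ?thesis using w(3) anti_lv_sym by blast
      qed
      then have uxc: "(u, x) \<in> conn_lv H \<pi> i" "(u, x) \<in> anti_lv H \<pi> i"
        using Pconn[OF i(1)] conn_lv_subset[of H \<pi> i] by blast+
      have "(u, z) \<in> anti_lv H \<pi> i" using uxc(2) i(2) by (rule anti_lv_trans)
      moreover have "(u, z) \<notin> ?P" using w(4) ux anti_lv_sym anti_lv_trans by blast
      moreover have "(x, z) \<in> ?L\<^sup>*"
        using free_links_switch_subset[OF _ _ _ uc, of "live H \<pi> i - {e1}" "live H \<pi> i - {e}" i]
          i(1,4) e3i[OF i(1)] e edges(4) by auto
      then have "(u, z) \<in> ?L\<^sup>*"
        using ux by (intro converse_rtrancl_into_rtrancl[of u x]) (auto simp: free_links_def)
      ultimately have "(u, z) \<in> conn_lv H \<pi> i" by (intro no_exchange_pair[OF e _ _ i(1)])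
      then show False
        using i(3) uxc(1) equiv_levels(2)[of H \<pi> i] unfolding equiv_def by (meson symD transD)
    qed
    have ne: "u \<noteq> a" "u \<noteq> b" "a \<noteq> b" using w(2) by (auto simp: card_insert_if split: if_splits)
    have "card {x, x', z} = 3" using w(1,2) by simp
    then have "{x, x'} = {x, x', z} - {z}" by (auto simp: card_insert_if split: if_splits)
    then have xx': "{x, x'} = {u, a, b} - {z}" by (simp only: w(1))
    have "z \<in> {u, a, b}" unfolding w(1) by simp
    then consider "z = b" "{x, x'} = {u, a}" | "z = a" "{x, x'} = {u, b}" | "z = u" "{x, x'} = {a, b}"
      using xx' ne by (elim insertE emptyE) (simp_all add: insert_Diff_if)
    then show False
    proof cases
      case 1
      then show False using key[of a e2] ends by auto
    next
      case 2
      then show False using key[of b e1] ends by auto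
    next
      case 3
      then have ab: "(a, b) \<in> ?P" using w(3) anti_lv_sym by (auto simp: doubleton_eq_iff)
      have ua: "(u, a) \<in> ?P" by (rule leaf_with_neighbours[OF ab])
      have "x = a \<or> x = b" using 3 by auto
      then have "(u, x) \<in> ?P" using ua anti_lv_trans[OF ua ab] by blast
      then show False using w(4) 3 anti_lv_sym by blast
    qed
  qed
  then have "g \<in> discards H' \<pi> ?P (hist H \<pi> (Suc k)) \<longleftrightarrow>
      g \<in> discards H \<pi> ?P (hist H \<pi> (Suc k)) \<and> g \<noteq> e3" if "g \<in> {e1, e2, e3}" for g
    using that card two edges(4) card_discards[of g H \<pi> ?P] card_discards[of g H' \<pi> ?P] by auto
  with old show ?thesis by (intro set_eqI) (metis DiffD1 DiffD2 DiffI insertI1 insertI2 singletonD singletonI)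
qed

text \<open>As long as \<open>u\<close> and \<open>c\<close> are not separated, the switch does not change the sequence of
  partitions; separating them makes \<open>e3\<close> a crossing hyperedge of size 3, or it is caused by
  discarding \<open>e3\<close>, and the switch improves the score.\<close>
lemma score_switch:
  assumes max: "\<not> lex_less (score H \<pi>) (score H' \<pi>)"
  shows "score H' \<pi> = score H \<pi>"
proof -
  have not_better: "\<not> score H \<pi> k < score H' \<pi> k" if "\<forall>l<k. score H' \<pi> l = score H \<pi> l" for k
    using max that unfolding lex_less_def by metis
  have "(u, c) \<in> anti_lv H \<pi> k \<and> e3 \<in> live H \<pi> k \<and> anti_lv H' \<pi> k = anti_lv H \<pi> k \<and>
      live H' \<pi> k = live H \<pi> k \<and> hist H' \<pi> k = hist H \<pi> k \<and> (\<forall>l<k. score H' \<pi> l = score H \<pi> l)" for k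
  proof (induction k)
    case 0
    have "{u, c} \<subseteq> verts H" using H edges(3) ends(3) unfolding three_hypergraph_def by blast
    then show ?case using edges by (simp add: hist_def)
  next
    case (Suc k)
    then have uck: "(u, c) \<in> anti_lv H \<pi> k" and e3k: "e3 \<in> live H \<pi> k"
      and eq: "anti_lv H' \<pi> k = anti_lv H \<pi> k" "live H' \<pi> k = live H \<pi> k" "hist H' \<pi> k = hist H \<pi> k"
      and sc: "\<forall>l<k. score H' \<pi> l = score H \<pi> l" by auto
    have conn: "conn_lv H' \<pi> k = conn_lv H \<pi> k" by (simp add: conn_lv_def eq)
    have ucC: "(u, c) \<in> conn_lv H \<pi> k"
      unfolding conn_lv_def using uck e3k pi by (intro conn_relI[of _ _ _ e3])
    let ?C = "conn_lv H \<pi> k" and ?R = "anti_rel (ends H') \<pi> (live H \<pi> k) (conn_lv H \<pi> k)"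
    have eqR: "equiv (verts H) ?R" by (rule equiv_anti_rel[OF equiv_levels(2)])
    have C: "(y, x) \<in> ?C" "(y, z) \<in> ?C \<Longrightarrow> (x, z) \<in> ?C" if "(x, y) \<in> ?C" for x y z
      using equiv_levels(2)[of H \<pi> k] that unfolding equiv_def by (meson symD transD)+
    \<comment> \<open>Every merging in \<open>H\<close> is imitated in \<open>H'\<close>: those by
      \<open>e1\<close> and \<open>e2\<close> through {u, a, b}, and those by \<open>e3\<close>,
      which acts only once \<open>u\<close> and \<open>c\<close> are merged, through {u, d}.\<close>
    have "anti_lv H \<pi> (Suc k) \<subseteq> ?R"
      unfolding anti_lv_Suc
    proof (rule anti_rel_subsetI[OF eqR equiv_levels(2)])
      fix f x y
      assume f: "f \<in> live H \<pi> k" "\<pi> f \<times> \<pi> f \<subseteq> ?R" "x \<in> ends H f" "y \<in> ends H f" "(x, y) \<in> ?C"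
      consider "f \<notin> {e1, e2, e3}" | "f = e1 \<or> f = e2" | "f = e3" "x = y" | "f = e3" "x \<noteq> y" by blast
      then show "(x, y) \<in> ?R"
      proof cases
        case 1
        then show ?thesis using f ends'(4) by (intro anti_rel_edgeI[of f]) auto
      next
        case 2
        then show ?thesis
          using f ends ends' pi pairs_live by (intro anti_rel_edgeI[of e1]) auto
      next
        case 3
        then show ?thesis using f(5) anti_rel.refl by metis
      next
        case 4
        have ucR: "(u, c) \<in> ?R" using f(2) 4 pi by auto
        have "x \<in> {u, c, d}" "y \<in> {u, c, d}" using f 4 ends by auto
        then consider "{x, y} = {u, c}" | "x = u \<and> y = d \<or> x = c \<and> y = d"
          | "x = d \<and> y = u \<or> x = d \<and> y = c" using 4 by auto
        then show ?thesis
        proof cases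
          case 1
          then show ?thesis using ucR anti_rel.sym by (metis doubleton_eq_iff)
        next
          case 2
          then have "(u, d) \<in> ?C" using f(5) ucC C by blast
          then have "(u, d) \<in> ?R"
            using ends' pi pairs_live by (intro anti_rel_edgeI[of e2]) auto
          then show ?thesis using 2 ucR anti_rel.sym anti_rel.trans by metis
        next
          case 3
          then have "(u, d) \<in> ?C" using f(5) ucC C by blast
          then have "(u, d) \<in> ?R"
            using ends' pi pairs_live by (intro anti_rel_edgeI[of e2]) auto
          then show ?thesis using 3 ucR anti_rel.sym anti_rel.trans by metis
        qed
      qed
    qed
    then have "anti_lv H \<pi> (Suc k) \<subseteq> anti_lv H' \<pi> (Suc k)"
      by (simp add: anti_lv_Suc eq conn)
    moreover have "\<not> anti_lv H \<pi> (Suc k) \<subset> anti_lv H' \<pi> (Suc k)"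
      using not_better[OF sc] score_less[OF three_hypergraph_switch, of H \<pi> k \<pi>] conn by auto
    ultimately have P: "anti_lv H' \<pi> (Suc k) = anti_lv H \<pi> (Suc k)" by blast
    let ?P = "anti_lv H \<pi> (Suc k)"
    let ?M = "{e \<in> hedges H. card (ends H e) = 3 \<longrightarrow> \<pi> e \<times> \<pi> e \<subseteq> ?P}"
    let ?M' = "{e \<in> hedges H. card (ends H' e) = 3 \<longrightarrow> \<pi> e \<times> \<pi> e \<subseteq> ?P}"
    have M': "?M' = insert e3 ?M"
    proof -
      have "card (ends H' e3) = 2" using sizes by (simp add: ends')
      then have "e \<in> ?M' \<longleftrightarrow> e \<in> insert e3 ?M" for e
        using edges ends'(4)[of e] pi by (cases "e \<in> {e1, e2, e3}") auto
      then show ?thesis by blast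
    qed
    have finM: "finite ?M" using H by (simp add: three_hypergraph_def)
    have ucP: "(u, c) \<in> ?P"
    \<comment> \<open>If this level separated \<open>u\<close> from \<open>c\<close>, then
      \<open>e3\<close> would be counted in \<open>H'\<close> but not in \<open>H\<close>, and the
      third component would grow.\<close>
    proof (rule ccontr)
      assume "(u, c) \<notin> ?P"
      then have "e3 \<notin> ?M" using card pi by auto
      then have "card ?M < card ?M'" unfolding M' using finM by simp
      then have "score H \<pi> k < score H' \<pi> k" by (simp add: score_def conn P)
      then show False using not_better[OF sc] by contradiction
    qed
    then have "e3 \<in> ?M" using pi equiv_pair[OF equiv_levels(1) ucP] edges by auto
    then have "score H' \<pi> k = score H \<pi> k"
      using M' by (simp add: score_def conn P insert_absorb)
    then have sc': "\<forall>l<Suc k. score H' \<pi> l = score H \<pi> l" using sc by (simp add: less_Suc_eq)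
    have hist: "hist H' \<pi> (Suc k) = hist H \<pi> (Suc k)" by (simp add: hist_Suc eq conn)
    let ?D = "discards H \<pi> ?P (hist H \<pi> (Suc k))"
    have live': "live H' \<pi> (Suc k) = live H \<pi> k - (?D - {e3})"
      by (simp add: live_Suc P hist eq discards_switch[OF ucP e3k])
    \<comment> \<open>Had \<open>H\<close> discarded \<open>e3\<close>, the leaf \<open>u\<close>
      would have no live used hyperedge at stage \<open>Suc k\<close>, while in \<open>H'\<close>
      the hyperedge \<open>e3\<close> stays live and joins it to \<open>c\<close>; the components of
      \<open>H'\<close> would be strictly coarser.\<close>
    have "e3 \<notin> ?D"
    proof
      assume "e3 \<in> ?D"
      then have no: "e3 \<notin> live H \<pi> (Suc k)" by (simp add: live_Suc)
      have "conn_lv H \<pi> (Suc k) \<subseteq> conn_lv H' \<pi> (Suc k)"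
        unfolding conn_lv_def P live' live_Suc[of H \<pi> k] by (intro conn_rel_mono) auto
      moreover have "(u, c) \<in> conn_lv H' \<pi> (Suc k)"
        unfolding conn_lv_def P using ucP pi e3k live' by (intro conn_relI[of _ _ _ e3]) auto
      moreover have "(u, c) \<notin> conn_lv H \<pi> (Suc k)"
      proof
        assume "(u, c) \<in> conn_lv H \<pi> (Suc k)"
        then have "(u, c) \<in> (?P \<inter> pair_links \<pi> (live H \<pi> (Suc k)))\<^sup>*"
          unfolding conn_lv_def conn_rel_def by blast
        then obtain y where "(u, y) \<in> pair_links \<pi> (live H \<pi> (Suc k))"
          using sizes(3) by (meson IntD2 converse_rtranclE)
        then obtain f where f: "f \<in> live H \<pi> (Suc k)" "u \<in> \<pi> f" unfolding pair_links_def by blast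
        then have "f = e3" using leaf live_subset_hedges[of H \<pi> "Suc k"] by blast
        then show False using no f(1) by simp
      qed
      ultimately have "conn_lv H \<pi> (Suc k) \<subset> conn_lv H' \<pi> (Suc k)" by blast
      then show False
        using score_less[OF three_hypergraph_switch, of H \<pi> "Suc k" \<pi>] not_better[OF sc'] by blast
    qed
    then show ?case using ucP P hist sc' live' e3k by (auto simp: live_Suc)
  qed
  then show ?thesis by (intro ext) blast
qed

lemma used_triples_switch:
  "card {e \<in> used H' \<pi>. card (ends H' e) = 3} < card {e \<in> used H \<pi>. card (ends H e) = 3}"
proof (rule psubset_card_mono)
  show "finite {e \<in> used H \<pi>. card (ends H e) = 3}"
    using H by (simp add: three_hypergraph_def used_def)
  have "card (ends H' e3) = 2" using sizes by (simp add: ends')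
  moreover have "e \<in> {e \<in> used H \<pi>. card (ends H e) = 3}"
    if "e \<in> {e \<in> used H' \<pi>. card (ends H' e) = 3}" for e
    using that calculation pi ends'(4)[of e] by (cases "e \<in> {e1, e2, e3}") (auto simp: used_def)
  moreover have "e3 \<in> {e \<in> used H \<pi>. card (ends H e) = 3}"
    using edges card pi by (auto simp: used_def)
  ultimately show "{e \<in> used H' \<pi>. card (ends H' e) = 3} \<subset> {e \<in> used H \<pi>. card (ends H e) = 3}"
    by force
qed

end

section \<open>Choosing the best configuration among the related hypergraphs\<close>

lemma transp_lex_less: "transp lex_less"
proof (rule transpI)
  fix f g h :: "nat \<Rightarrow> 'a"
  assume "lex_less f g" "lex_less g h"
  then obtain m n where m: "\<forall>l<m. f l = g l" "f m < g m" and n: "\<forall>l<n. g l = h l" "g n < h n"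
    unfolding lex_less_def by blast
  have "(\<forall>l<min m n. f l = h l) \<and> f (min m n) < h (min m n)"
    using m n by (cases m n rule: linorder_cases) (auto simp: min_def)
  then show "lex_less f h" unfolding lex_less_def by blast
qed

lemma asymp_lex_less: "asymp lex_less"
proof (rule asympI, rule notI)
  fix f g :: "nat \<Rightarrow> 'a"
  assume "lex_less f g" "lex_less g f"
  then have "lex_less f f" using transp_lex_less by (metis transpD)
  then show False unfolding lex_less_def by simp
qed

lemma switch_step_same:
  assumes "switch_step r H H'"
  shows "verts H' = verts H \<and> hedges H' = hedges H \<and> (\<forall>e. e \<notin> hedges H \<longrightarrow> ends H' e = ends H e)"
proof -
  obtain \<pi> \<pi>' u where "switch_at r u H \<pi> H' \<pi>'" using assms unfolding switch_step_def by blast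
  then show ?thesis
  proof cases
    case (1 e1 e2 e3 a b d c)
    then have "e1 \<in> hedges H" "e2 \<in> hedges H" "e3 \<in> hedges H" by (auto simp: incident_hedges_def)
    then show ?thesis using 1 by auto
  qed
qed

text \<open>The clause on labels outside \<open>hedges\<close> pins down the whole record, so that
  only finitely many values \<open>H'\<close> occur.\<close>

lemma related_same:
  assumes "related r H H'"
  shows "verts H' = verts H \<and> hedges H' = hedges H \<and> (\<forall>e. e \<notin> hedges H \<longrightarrow> ends H' e = ends H e)"
  using assms unfolding related_def
  by (induction rule: rtranclp_induct) (simp_all add: switch_step_same)

lemma finite_configurations:
  assumes "three_hypergraph H"
  shows "finite {(H', \<pi>). related r H H' \<and> three_hypergraph H' \<and> admissible H' \<pi>}"
proof -
  let ?V = "verts H" and ?E = "hedges H"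
  let ?M = "{f. \<forall>x. (x \<in> ?E \<longrightarrow> f x \<in> Pow ?V) \<and> (x \<notin> ?E \<longrightarrow> f x = {})}"
  let ?c = "\<lambda>(f, \<pi>). (H\<lparr>ends := \<lambda>e. if e \<in> ?E then f e else ends H e\<rparr>, \<pi>)"
  have "finite ?M"
    using assms by (intro finite_set_of_finite_funs) (auto simp: three_hypergraph_def)
  moreover have "{(H', \<pi>). related r H H' \<and> three_hypergraph H' \<and> admissible H' \<pi>} \<subseteq> ?c ` (?M \<times> ?M)"
  proof clarify
    fix H' \<pi>
    assume A: "related r H H'" "three_hypergraph H'" "admissible H' \<pi>"
    note same = related_same[OF A(1)]
    have ends: "ends H' e \<subseteq> ?V" if "e \<in> ?E" for e
      using A(2) that same by (auto simp: three_hypergraph_def)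
    define f where "f = (\<lambda>e. if e \<in> ?E then ends H' e else {})"
    have "\<pi> e \<subseteq> ends H' e" if "e \<in> ?E" for e
      using A(3) that same unfolding admissible_def quasigraph_def by auto
    then have "\<pi> \<in> ?M" using A(3) ends same by (auto simp: admissible_def)
    moreover have "f \<in> ?M" using ends by (auto simp: f_def)
    moreover have "H' = H\<lparr>ends := \<lambda>e. if e \<in> ?E then f e else ends H e\<rparr>"
      using same by (intro hypergraph.equality) (auto simp: f_def fun_eq_iff)
    ultimately show "(H', \<pi>) \<in> ?c ` (?M \<times> ?M)" by (intro image_eqI[of _ _ "(f, \<pi>)"]) auto
  qed
  ultimately show ?thesis by (meson finite_SigmaI finite_imageI finite_subset)
qed

lemma bad_leaf_hyperedges:
  assumes H: "three_hypergraph H" and opt: "optimal H \<pi>" and bad: "bad_leaf r H \<pi> u"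
  obtains e1 e2 e3 a b c d where
    "bad_leaf_switch H (H\<lparr>ends := (ends H)(e1 := {u, a, b}, e2 := {u, d}, e3 := {u, c})\<rparr>)
      \<pi> u a b c d e1 e2 e3"
    "incident_hedges H u = {e1, e2, e3}"
proof -
  have adm: "admissible H \<pi>" using opt by (simp add: optimal_def)
  have quasi: "\<pi> f = {} \<or> \<pi> f \<subseteq> ends H f \<and> card (\<pi> f) = 2" if "f \<in> hedges H" for f
    using adm that unfolding admissible_def quasigraph_def by blast
  obtain e3 where e3: "{f \<in> incident_hedges H u. card (ends H f) = 3} = {e3}"
      "associated r H \<pi> e3 u" and lf: "leaf (star H \<pi>) u" and three: "card (incident_hedges H u) = 3"
    using bad unfolding bad_leaf_def by blast
  obtain vs es where p: "e3 \<in> used H \<pi>" "graph_path (star H \<pi>) vs (e3 # es)" "hd vs = u"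
    using e3(2) unfolding associated_def is_tail_def by blast
  then have "\<pi> e3 = {vs ! 0, vs ! 1}" "vs \<noteq> []" by (auto simp: graph_path_def star_def)
  with p(3) obtain c where c: "\<pi> e3 = {u, c}" by (metis hd_conv_nth)
  have e3H: "e3 \<in> hedges H" "card (ends H e3) = 3" "e3 \<in> incident_hedges H u"
    using e3(1) by (auto simp: incident_hedges_def)
  have uc: "u \<in> ends H e3" "c \<in> ends H e3" "u \<noteq> c"
    using quasi[OF e3H(1)] c by (auto simp: card_insert_if split: if_splits)
  then have "card (ends H e3 - {u, c}) = 1"
    using e3H(2) by (subst card_Diff_subset) auto
  then obtain d where "ends H e3 - {u, c} = {d}" by (metis card_1_singletonE)
  then have d: "ends H e3 = {u, c, d}" using uc by blast
  have fin: "finite (incident_hedges H u)" using three by (simp add: card_ge_0_finite)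
  have "card (incident_hedges H u - {e3}) = 2" using three e3H(3) fin by simp
  then obtain e1 e2 where e12: "incident_hedges H u - {e3} = {e1, e2}" "e1 \<noteq> e2"
    by (meson card_2_iff)
  then have inc: "incident_hedges H u = {e1, e2, e3}" "distinct [e1, e2, e3]"
    using e3H(3) by auto
  have pair: "card (ends H f) = 2 \<and> (\<exists>a. ends H f = {u, a})" if "f \<in> {e1, e2}" for f
  proof -
    have f: "f \<in> incident_hedges H u" "f \<noteq> e3" using that inc by auto
    then have "card (ends H f) \<noteq> 3" using e3(1) by blast
    moreover have "card (ends H f) \<in> {2, 3}"
      using f(1) H by (auto simp: incident_hedges_def three_hypergraph_def)
    ultimately have 2: "card (ends H f) = 2" by simp
    moreover have "u \<in> ends H f" using f(1) by (simp add: incident_hedges_def)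
    ultimately show ?thesis by (metis card_2_iff insert_commute insertE singletonD)
  qed
  obtain a b where ab: "ends H e1 = {u, a}" "ends H e2 = {u, b}"
    using pair[of e1] pair[of e2] by auto
  have "card (incident_hedges (star H \<pi>) u) = 1" using lf by (simp add: leaf_def)
  moreover have "e3 \<in> incident_hedges (star H \<pi>) u"
    using p(1) c by (simp add: incident_hedges_def star_def)
  ultimately have one: "incident_hedges (star H \<pi>) u = {e3}"
    by (metis card_1_singletonE singletonD)
  have leaf: "f = e3" if "f \<in> hedges H" "u \<in> \<pi> f" for f
  proof -
    have "f \<in> incident_hedges (star H \<pi>) u"
      using that by (auto simp: incident_hedges_def star_def used_def)
    then show ?thesis using one by simp
  qed
  have empty: "\<pi> f = {}" if f: "f \<in> {e1, e2}" for f
  proof (rule ccontr)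
    assume ne: "\<pi> f \<noteq> {}"
    have fH: "f \<in> hedges H" "u \<in> ends H f" "f \<noteq> e3" using f inc by (auto simp: incident_hedges_def)
    have "\<pi> f \<subseteq> ends H f" "card (\<pi> f) = 2" "card (ends H f) = 2"
      using quasi[OF fH(1)] ne pair[OF f] by auto
    then have "\<pi> f = ends H f" by (metis card_subset_eq card.infinite zero_neq_numeral)
    then show False using leaf[OF fH(1)] fH by simp
  qed
  have "bad_leaf_switch H (H\<lparr>ends := (ends H)(e1 := {u, a, b}, e2 := {u, d}, e3 := {u, c})\<rparr>)
      \<pi> u a b c d e1 e2 e3"
  proof
    show "e1 \<in> hedges H" "e2 \<in> hedges H" using inc by (auto simp: incident_hedges_def)
    show "card (ends H e1) = 2" "card (ends H e2) = 2" using pair by simp_all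
    show "\<pi> e1 = {}" "\<pi> e2 = {}" using empty by simp_all
  qed (rule H opt e3H inc ab d c | erule (1) leaf | simp)+
  then show thesis by (rule that[OF _ inc(1)])
qed

theorem theorem16:
  fixes H :: "('v, 'e) hypergraph" and r :: "'v roots"
  assumes "three_hypergraph H"
    and "root_choice (verts H) r"
  shows "\<exists>H' \<sigma> S. three_hypergraph H' \<and> related r H H' \<and> acyclic_quasigraph H' \<sigma> \<and>
           (\<forall>u\<in>verts H'. \<not> bad_leaf r H' \<sigma> u) \<and> skeletal H' \<sigma> S"
proof -
  let ?A = "{(H', \<pi>). related r H H' \<and> three_hypergraph H' \<and> admissible H' \<pi>}"
  let ?s = "\<lambda>(H', \<pi>). score H' \<pi>" and ?t = "\<lambda>(H', \<pi>). card {e \<in> used H' \<pi>. card (ends H' e) = 3}"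
  define best where "best x \<longleftrightarrow> x \<in> ?A \<and> (\<forall>y\<in>?A. \<not> lex_less (?s x) (?s y))" for x
  have "(H, \<lambda>_. {}) \<in> ?A"
    using assms(1) by (auto simp: related_def admissible_def quasigraph_def acyc_def)
  then have ne: "?A \<noteq> {}" by blast
  have "\<exists>x. best x"
  proof -
    let ?R = "\<lambda>x y. lex_less (?s x) (?s y)"
    have "asymp_on ?A ?R" by (intro asymp_onI) (rule asympD[OF asymp_lex_less])
    moreover have "transp_on ?A ?R" by (intro transp_onI) (rule transpD[OF transp_lex_less])
    ultimately have "\<exists>m\<in>?A. \<forall>x\<in>?A. x \<noteq> m \<longrightarrow> \<not> ?R m x"
      using ne by (intro Finite_Set.bex_max_element finite_configurations assms(1))
    then obtain m where m: "m \<in> ?A" "\<forall>x\<in>?A. x \<noteq> m \<longrightarrow> \<not> ?R m x" by (rule bexE)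
    have irr: "\<not> ?R m m" by (rule notI) (frule asympD[OF asymp_lex_less], erule notE)
    have "best m" unfolding best_def
    proof (intro conjI ballI m(1))
      fix y assume y: "y \<in> ?A"
      show "\<not> ?R m y"
      proof (cases "y = m")
        case False
        then show ?thesis by (rule m(2)[rule_format, OF y])
      qed (simp only: irr not_False_eq_True)
    qed
    then show ?thesis by (rule exI)
  qed
  \<comment> \<open>Among the configurations of maximal score, one with the fewest used triples is
    taken, because a switch at a bad leaf would keep the score and lower this number.\<close>
  then obtain x where x: "best x" "\<forall>y. best y \<longrightarrow> ?t x \<le> ?t y"
    using ex_has_least_nat[of best _ ?t] by blast
  obtain H' \<sigma> where eq: "x = (H', \<sigma>)" by fastforce
  have conf: "related r H H'" "three_hypergraph H'" "admissible H' \<sigma>"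
    using x(1) unfolding best_def eq by auto
  have max: "\<not> lex_less (score H' \<sigma>) (score H'' \<rho>)"
    if "related r H H''" "three_hypergraph H''" "admissible H'' \<rho>" for H'' \<rho>
    using x(1) that unfolding best_def eq by auto
  have opt: "optimal H' \<sigma>" unfolding optimal_def using conf max by blast
  have acyc: "acyclic_quasigraph H' \<sigma>"
    using conf(3) forest_star_iff[OF conf(2)] by (simp add: acyclic_quasigraph_def admissible_def)
  have "\<not> bad_leaf r H' \<sigma> u" for u
  proof
    assume bad: "bad_leaf r H' \<sigma> u"
    obtain e1 e2 e3 a b c d where sw: "bad_leaf_switch H'
        (H'\<lparr>ends := (ends H')(e1 := {u, a, b}, e2 := {u, d}, e3 := {u, c})\<rparr>) \<sigma> u a b c d e1 e2 e3"
      and inc: "incident_hedges H' u = {e1, e2, e3}"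
      by (rule bad_leaf_hyperedges[OF conf(2) opt bad])
    define H2 where "H2 = H'\<lparr>ends := (ends H')(e1 := {u, a, b}, e2 := {u, d}, e3 := {u, c})\<rparr>"
    interpret sw: bad_leaf_switch H' H2 \<sigma> u a b c d e1 e2 e3
      using sw by (simp add: H2_def)
    have "switch_at r u H' \<sigma> H2 (\<sigma>(e1 := {}, e2 := {}, e3 := {u, c}))"
      unfolding H2_def by (rule switch_at.intros[OF bad inc sw.edges(4) sw.ends sw.pi(3)])
    then have "switch_step r H' H2" using acyc unfolding switch_step_def by blast
    with conf(1) have "related r H H2"
      unfolding related_def by (rule rtranclp.rtrancl_into_rtrancl)
    \<comment> \<open>The switch only has to supply \<open>H2\<close>; the new configuration pairs
      it with the unchanged \<sigma>.\<close>
    then have mem: "(H2, \<sigma>) \<in> ?A" using sw.three_hypergraph_switch sw.admissible_switch by auto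
    then have "score H2 \<sigma> = score H' \<sigma>" using max by (intro sw.score_switch) auto
    then have "best (H2, \<sigma>)" using x(1) mem unfolding best_def eq by auto
    then have "?t (H', \<sigma>) \<le> ?t (H2, \<sigma>)" using x(2) unfolding eq by blast
    then show False using sw.used_triples_switch by simp
  qed
  then show ?thesis using conf acyc optimal_skeletal[OF conf(2) opt] by blast
qed

end
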